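(* Let $\sigma>0$. For each $n\ge 1$ let $(X_n^1,\dots,X_n^n)$ be a random vector in $\mathbb{R}^n$ with distribution $\widetilde{\mu}_{n,\sigma}$, and set $S_n=X_n^1+\dots+X_n^n$ and $T_n=(X_n^1)^2+\dots+(X_n^n)^2$. Then, as $n\to+\infty$, $(S_n/n,\,T_n/n)$ converges in probability to $(0,\sigma^2)$. Moreover, as $n\to+\infty$, $S_n/n^{3/4}$ converges in distribution to the probability measure on $\mathbb{R}$ $$\left(\frac{\sigma}{\sqrt{2}}\,\Gamma\!\left(\frac14\right)\right)^{-1}\exp\left(-\frac{x^4}{4\sigma^4}\right)dx .$$
   Context: For $\sigma>0$, $\rho_\sigma$ denotes the Gaussian distribution on $\mathbb{R}$ with mean $0$ and variance $\sigma^2$. For $n\ge 1$, $\widetilde{\mu}_{n,\sigma}$ is the probability measure on $\mathbb{R}^n$ defined by $$d\widetilde{\mu}_{n,\sigma}(x_1,\dots,x_n)=\frac{1}{Z_n}\exp\left(\frac12\,\frac{(x_1+\dots+x_n)^2}{x_1^2+\dots+x_n^2}\right)\prod_{i=1}^n d\rho_\sigma(x_i),$$ where the normalization constant (whose value does not depend on $\sigma$) is $$Z_n=\int_{\mathbb{R}^n}(2\pi)^{-n/2}\exp\left(\frac12\,\frac{(x_1+\dots+x_n)^2}{x_1^2+\dots+x_n^2}-\frac12(x_1^2+\dots+x_n^2)\right)\prod_{i=1}^n dx_i .$$ The set $\{x_1^2+\dots+x_n^2=0\}$ is negligible, so the density is defined almost everywhere. $\Gamma(z)=\int_0^{+\infty}x^{z-1}e^{-x}\,dx$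 for $z>0$. *)

theory Defs
  imports "HOL-Probability.Probability"
begin

text \<open>
  Vectors in $R^n$, with $n$ varying, are elements of the space of
  \<open>PiM {1..n} (\<lambda>_. borel)\<close>: functions on \<open>nat\<close> that are \<open>undefined\<close> outside \<open>{1..n}\<close>.
\<close>

definition gauss :: "real \<Rightarrow> real measure" where
  "gauss \<sigma> = density lborel (\<lambda>x. ennreal (normal_density 0 \<sigma> x))"

text \<open>At the origin (a null set for \<open>n \<ge> 1\<close>) the quotient is \<open>0\<close>, as \<open>0 / 0 = 0\<close>.\<close>

definition interaction :: "nat \<Rightarrow> (nat \<Rightarrow> real) \<Rightarrow> real" where
  "interaction n x = 1 / 2 * ((\<Sum>i=1..n. x i)\<^sup>2 / (\<Sum>i=1..n. (x i)\<^sup>2))"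

definition Z :: "nat \<Rightarrow> real" where
  "Z n = (\<integral>x. (2 * pi) powr (- real n / 2) *
              exp (interaction n x - 1 / 2 * (\<Sum>i=1..n. (x i)\<^sup>2))
            \<partial>(PiM {1..n} (\<lambda>_. lborel)))"

definition mu_tilde :: "nat \<Rightarrow> real \<Rightarrow> (nat \<Rightarrow> real) measure" where
  "mu_tilde n \<sigma> = density (PiM {1..n} (\<lambda>_. gauss \<sigma>))
                      (\<lambda>x. ennreal (1 / Z n * exp (interaction n x)))"

text \<open>The \<open>n\<close>-th random variable may live on its own probability space \<open>M n\<close>.\<close>

definition conv_in_prob ::
    "(nat \<Rightarrow> 'a measure) \<Rightarrow> (nat \<Rightarrow> 'a \<Rightarrow> 'b::metric_space) \<Rightarrow> 'b \<Rightarrow> bool" where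
  "conv_in_prob M Y c \<longleftrightarrow>
     (\<forall>\<epsilon>>0. (\<lambda>n. measure (M n) {\<omega> \<in> space (M n). dist (Y n \<omega>) c > \<epsilon>}) \<longlonglongrightarrow> 0)"

definition quartic_measure :: "real \<Rightarrow> real measure" where
  "quartic_measure \<sigma> = density lborel
     (\<lambda>x. ennreal (inverse (\<sigma> / sqrt 2 * Gamma (1 / 4)) * exp (- (x ^ 4) / (4 * \<sigma> ^ 4))))"

end

theory Submission
  imports Defs "HOL-Real_Asymp.Real_Asymp"
begin

text \<open>
  By the Hubbard--Stratonovich identity
  \<open>sqrt (2 * pi) * exp (S\<^sup>2 / (2 * T)) = \<integral> sqrt T * exp (y * S - y\<^sup>2 * T / 2) dy\<close>,
  the measure \<open>mu_tilde n \<sigma>\<close> is, up to the factor \<open>sqrt T\<close>, a mixture over \<open>y\<close> of products of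
  \<open>n\<close> identical normal laws with mean \<open>\<sigma>\<^sup>2 * y / (1 + \<sigma>\<^sup>2 * y\<^sup>2)\<close> and variance \<open>\<sigma>\<^sup>2 / (1 + \<sigma>\<^sup>2 * y\<^sup>2)\<close>,
  the weight of \<open>y\<close> being \<open>\<phi> y ^ n\<close> with
  \<open>\<phi> y = exp (\<sigma>\<^sup>2 * y\<^sup>2 / (2 * (1 + \<sigma>\<^sup>2 * y\<^sup>2))) / sqrt (1 + \<sigma>\<^sup>2 * y\<^sup>2) \<approx> exp (- \<sigma> ^ 4 * y ^ 4 / 4)\<close>.
  At the scale \<open>y = x / (\<sigma>\<^sup>2 * n powr (1 / 4))\<close> the weights converge to \<open>exp (- x ^ 4 / (4 * \<sigma> ^ 4))\<close>, while
  under the corresponding product law \<open>S / n powr (3 / 4)\<close> concentrates at \<open>x\<close> and \<open>T / n\<close> at \<open>\<sigma>\<^sup>2\<close>,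
  by second moments. Dominated convergence in \<open>x\<close> concludes.
\<close>

subsection \<open>Gaussian linearisation of the interaction\<close>

declare One_nat_def [simp del]

text \<open>A product of sigma-finite measures is determined by its values on boxes. On
  \<open>Pi\<^sub>E I A\<close> the indicator splits into coordinate indicators, and the integral of
  a product of one-variable functions is the product of their integrals.\<close>

lemma PiM_density:
  assumes I: "finite I"
    and sf: "\<And>i. sigma_finite_measure (M i)"
    and f [measurable]: "\<And>i. f i \<in> borel_measurable (M i)"
    and sfd: "\<And>i. sigma_finite_measure (density (M i) (f i))"
  shows "PiM I (\<lambda>i. density (M i) (f i)) = density (PiM I M) (\<lambda>x. \<Prod>i\<in>I. f i (x i))"
proof -
  interpret product_sigma_finite M by (simp add: product_sigma_finite_def sf)
  interpret D: product_sigma_finite "\<lambda>i. density (M i) (f i)" by (simp add: product_sigma_finite_def sfd)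
  show ?thesis
  proof (rule D.PiM_eqI[symmetric])
  show "finite I" by fact
  show "sets (density (PiM I M) (\<lambda>x. \<Prod>i\<in>I. f i (x i))) = sets (PiM I (\<lambda>i. density (M i) (f i)))"
    using sets_PiM_cong[OF refl, of I "\<lambda>i. density (M i) (f i)" M] by simp
  fix A assume "\<And>i. i \<in> I \<Longrightarrow> A i \<in> sets (density (M i) (f i))"
  then have A [measurable]: "\<And>i. i \<in> I \<Longrightarrow> A i \<in> sets (M i)" by simp
  have [measurable]: "Pi\<^sub>E I A \<in> sets (PiM I M)"
    using I A by (intro sets_PiM_I_finite) auto
  have "emeasure (density (PiM I M) (\<lambda>x. \<Prod>i\<in>I. f i (x i))) (Pi\<^sub>E I A)
      = (\<integral>\<^sup>+x. (\<Prod>i\<in>I. f i (x i)) * indicator (Pi\<^sub>E I A) x \<partial>PiM I M)"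
    using I by (intro emeasure_density) auto
  also have "\<dots> = (\<integral>\<^sup>+x. (\<Prod>i\<in>I. f i (x i) * indicator (A i) (x i)) \<partial>PiM I M)"
  proof (rule nn_integral_cong)
    fix x assume x: "x \<in> space (PiM I M)"
    have "indicator (Pi\<^sub>E I A) x = (\<Prod>i\<in>I. indicator (A i) (x i) :: ennreal)"
    proof (cases "x \<in> Pi\<^sub>E I A")
      case True
      then have "\<And>i. i \<in> I \<Longrightarrow> x i \<in> A i" by auto
      then show ?thesis using True by simp
    next
      case False
      with x obtain i where "i \<in> I" "x i \<notin> A i"
        by (auto simp: space_PiM PiE_def Pi_def)
      then show ?thesis using False I by (auto simp: prod_zero_iff intro!: bexI[of _ i])
    qed
    then show "(\<Prod>i\<in>I. f i (x i)) * indicator (Pi\<^sub>E I A) x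
        = (\<Prod>i\<in>I. f i (x i) * indicator (A i) (x i))"
      by (simp add: prod.distrib)
  qed
  also have "\<dots> = (\<Prod>i\<in>I. \<integral>\<^sup>+x. f i x * indicator (A i) x \<partial>M i)"
    using I by (intro product_nn_integral_prod) auto
  also have "\<dots> = (\<Prod>i\<in>I. emeasure (density (M i) (f i)) (A i))"
    by (intro prod.cong refl) (simp add: emeasure_density)
  finally show "emeasure (density (PiM I M) (\<lambda>x. \<Prod>i\<in>I. f i (x i))) (Pi\<^sub>E I A)
      = (\<Prod>i\<in>I. emeasure (density (M i) (f i)) (A i))" .
  qed
qed

text \<open>Mean, standard deviation and total mass of the measure with density
  \<open>exp (y * x - y^2 * x^2 / 2)\<close> relative to \<open>gauss \<sigma>\<close>, as
  \<open>tilt_normal_density\<close> shows; the inverse variance is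
  \<open>1 / \<sigma>^2 + y^2\<close>.\<close>

definition tilt_mean :: "real \<Rightarrow> real \<Rightarrow> real" where
  "tilt_mean \<sigma> y = \<sigma>\<^sup>2 * y / (1 + \<sigma>\<^sup>2 * y\<^sup>2)"

definition tilt_sd :: "real \<Rightarrow> real \<Rightarrow> real" where
  "tilt_sd \<sigma> y = \<sigma> / sqrt (1 + \<sigma>\<^sup>2 * y\<^sup>2)"

definition tilt_mass :: "real \<Rightarrow> real \<Rightarrow> real" where
  "tilt_mass \<sigma> y = exp (\<sigma>\<^sup>2 * y\<^sup>2 / (2 * (1 + \<sigma>\<^sup>2 * y\<^sup>2))) / sqrt (1 + \<sigma>\<^sup>2 * y\<^sup>2)"

definition tilted_gauss :: "real \<Rightarrow> real \<Rightarrow> real measure" where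
  "tilted_gauss \<sigma> y = density lborel (\<lambda>x. ennreal (normal_density (tilt_mean \<sigma> y) (tilt_sd \<sigma> y) x))"

abbreviation tilted :: "nat \<Rightarrow> real \<Rightarrow> real \<Rightarrow> (nat \<Rightarrow> real) measure" where
  "tilted n \<sigma> y \<equiv> PiM {1..n} (\<lambda>_. tilted_gauss \<sigma> y)"

lemma one_plus_sq_pos [simp]: "0 < 1 + (\<sigma>::real)\<^sup>2 * y\<^sup>2"
  by (simp add: add_pos_nonneg)

lemma tilt_sd_pos: "0 < \<sigma> \<Longrightarrow> 0 < tilt_sd \<sigma> y"
  by (simp add: tilt_sd_def)

lemma tilt_mass_pos: "0 < tilt_mass \<sigma> y"
  by (simp add: tilt_mass_def)

text \<open>Completing the square in \<open>x\<close>: the coefficients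
  \<open>1 / \<sigma>^2 + y^2\<close> and \<open>y\<close> fix the variance and the mean, the
  constant left over is the exponent of \<open>tilt_mass\<close>, and the change of prefactor is its
  denominator.\<close>

lemma tilt_normal_density:
  assumes "0 < \<sigma>"
  shows "exp (y * x - y\<^sup>2 * x\<^sup>2 / 2) * normal_density 0 \<sigma> x
    = tilt_mass \<sigma> y * normal_density (tilt_mean \<sigma> y) (tilt_sd \<sigma> y) x"
proof -
  define w where "w = 1 + \<sigma>\<^sup>2 * y\<^sup>2"
  have w: "0 < w" by (simp add: w_def)
  have sd: "(tilt_sd \<sigma> y)\<^sup>2 = \<sigma>\<^sup>2 / w"
    using w by (simp add: tilt_sd_def w_def[symmetric] power_divide)
  have "y * x - y\<^sup>2 * x\<^sup>2 / 2 + - (x\<^sup>2) / (2 * \<sigma>\<^sup>2)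
      = \<sigma>\<^sup>2 * y\<^sup>2 / (2 * w) + - ((x - \<sigma>\<^sup>2 * y / w)\<^sup>2) / (2 * (\<sigma>\<^sup>2 / w))"
  proof -
    have "(x - \<sigma>\<^sup>2 * y / w)\<^sup>2 / (2 * (\<sigma>\<^sup>2 / w)) = x\<^sup>2 * w / (2 * \<sigma>\<^sup>2) - x * y + \<sigma>\<^sup>2 * y\<^sup>2 / (2 * w)"
      using w assms by (simp add: field_simps power2_eq_square)
    also have "x\<^sup>2 * w / (2 * \<sigma>\<^sup>2) = x\<^sup>2 / (2 * \<sigma>\<^sup>2) + y\<^sup>2 * x\<^sup>2 / 2"
      using assms by (simp add: w_def field_simps)
    finally show ?thesis by (simp add: algebra_simps)
  qed
  then have e: "exp (y * x - y\<^sup>2 * x\<^sup>2 / 2) * exp (- (x\<^sup>2) / (2 * \<sigma>\<^sup>2))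
      = exp (\<sigma>\<^sup>2 * y\<^sup>2 / (2 * w)) * exp (- ((x - \<sigma>\<^sup>2 * y / w)\<^sup>2) / (2 * (\<sigma>\<^sup>2 / w)))"
    by (simp only: exp_add[symmetric])
  have r: "1 / sqrt (2 * pi * \<sigma>\<^sup>2) = 1 / sqrt w * (1 / sqrt (2 * pi * (\<sigma>\<^sup>2 / w)))"
    using w assms by (simp add: real_sqrt_mult real_sqrt_divide)
  have "exp (y * x - y\<^sup>2 * x\<^sup>2 / 2) * normal_density 0 \<sigma> x
    = 1 / sqrt (2 * pi * \<sigma>\<^sup>2) * (exp (y * x - y\<^sup>2 * x\<^sup>2 / 2) * exp (- (x\<^sup>2) / (2 * \<sigma>\<^sup>2)))"
    by (simp add: normal_density_def)
  also have "\<dots> = tilt_mass \<sigma> y * normal_density (tilt_mean \<sigma> y) (tilt_sd \<sigma> y) x"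
    unfolding e r by (simp add: normal_density_def sd tilt_mass_def tilt_mean_def w_def[symmetric])
  finally show ?thesis .
qed

lemma sets_tilted_gauss [measurable_cong, simp]: "sets (tilted_gauss \<sigma> y) = sets borel"
  by (simp add: tilted_gauss_def)

lemma sets_gauss [measurable_cong, simp]: "sets (gauss \<sigma>) = sets borel"
  by (simp add: gauss_def)

lemma prob_space_tilted_gauss: "0 < \<sigma> \<Longrightarrow> prob_space (tilted_gauss \<sigma> y)"
  unfolding tilted_gauss_def by (intro prob_space_normal_density tilt_sd_pos)

lemma prob_space_gauss: "0 < \<sigma> \<Longrightarrow> prob_space (gauss \<sigma>)"
  unfolding gauss_def by (intro prob_space_normal_density)

lemma sets_PiM_real: "(\<And>i. sets (N i) = sets (borel :: real measure)) \<Longrightarrow> 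
    sets (PiM I N) = sets (PiM I (\<lambda>_. borel))"
  by (intro sets_PiM_cong) auto

text \<open>The exponent is a sum over the coordinates, so the product law is tilted one coordinate
  at a time, and each of the \<open>n\<close> coordinates contributes one factor
  \<open>tilt_mass \<sigma> y\<close>.\<close>

lemma nn_integral_gauss_tilt:
  assumes s: "0 < \<sigma>" and G: "G \<in> borel_measurable (PiM {1..n} (\<lambda>_. borel :: real measure))"
  shows "(\<integral>\<^sup>+x. G x * ennreal (exp (y * (\<Sum>i=1..n. x i) - y\<^sup>2 * (\<Sum>i=1..n. (x i)\<^sup>2) / 2))
            \<partial>PiM {1..n} (\<lambda>_. gauss \<sigma>))
       = ennreal (tilt_mass \<sigma> y ^ n) * (\<integral>\<^sup>+x. G x \<partial>tilted n \<sigma> y)"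
proof -
  have lsets: "sets (PiM {1..n} (\<lambda>_. lborel)) = sets (PiM {1..n} (\<lambda>_. borel :: real measure))"
    by (intro sets_PiM_real) simp
  have [measurable]: "G \<in> borel_measurable (PiM {1..n} (\<lambda>_. lborel :: real measure))"
    using G lsets by (simp cong: measurable_cong_sets)
  let ?g = "normal_density 0 \<sigma>" and ?h = "normal_density (tilt_mean \<sigma> y) (tilt_sd \<sigma> y)"
  have g: "PiM {1..n} (\<lambda>_. gauss \<sigma>) = density (PiM {1..n} (\<lambda>_. lborel)) (\<lambda>x. \<Prod>i=1..n. ennreal (?g (x i)))"
    unfolding gauss_def
    by (intro PiM_density) (auto intro!: prob_space_imp_sigma_finite prob_space_normal_density s sigma_finite_lborel)
  have h: "tilted n \<sigma> y = density (PiM {1..n} (\<lambda>_. lborel)) (\<lambda>x. \<Prod>i=1..n. ennreal (?h (x i)))"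
    unfolding tilted_gauss_def
    by (intro PiM_density) (auto intro!: prob_space_imp_sigma_finite prob_space_normal_density s sigma_finite_lborel tilt_sd_pos)
  have eq: "(\<Prod>i=1..n. ?g (x i)) * exp (y * (\<Sum>i=1..n. x i) - y\<^sup>2 * (\<Sum>i=1..n. (x i)\<^sup>2) / 2)
      = tilt_mass \<sigma> y ^ n * (\<Prod>i=1..n. ?h (x i))" for x :: "nat \<Rightarrow> real"
  proof -
    have "exp (y * (\<Sum>i=1..n. x i) - y\<^sup>2 * (\<Sum>i=1..n. (x i)\<^sup>2) / 2) = (\<Prod>i=1..n. exp (y * x i - y\<^sup>2 * (x i)\<^sup>2 / 2))"
      by (simp add: exp_sum[symmetric] sum_subtractf sum_distrib_left sum_divide_distrib)
    then have "(\<Prod>i=1..n. ?g (x i)) * exp (y * (\<Sum>i=1..n. x i) - y\<^sup>2 * (\<Sum>i=1..n. (x i)\<^sup>2) / 2)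
      = (\<Prod>i=1..n. exp (y * x i - y\<^sup>2 * (x i)\<^sup>2 / 2) * ?g (x i))"
      by (simp add: prod.distrib mult.commute)
    also have "\<dots> = tilt_mass \<sigma> y ^ n * (\<Prod>i=1..n. ?h (x i))"
      by (simp add: tilt_normal_density[OF s] prod.distrib)
    finally show ?thesis .
  qed
  have "(\<integral>\<^sup>+x. G x * ennreal (exp (y * (\<Sum>i=1..n. x i) - y\<^sup>2 * (\<Sum>i=1..n. (x i)\<^sup>2) / 2))
            \<partial>PiM {1..n} (\<lambda>_. gauss \<sigma>))
     = (\<integral>\<^sup>+x. ennreal (tilt_mass \<sigma> y ^ n) * ((\<Prod>i=1..n. ennreal (?h (x i))) * G x) \<partial>PiM {1..n} (\<lambda>_. lborel))"
    unfolding g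
    apply (subst nn_integral_density)
      apply measurable
    apply (intro nn_integral_cong)
    subgoal for x
      using arg_cong[OF eq[of x], of ennreal]
      by (simp add: prod_ennreal prod_nonneg ennreal_mult' mult_ac less_imp_le[OF tilt_mass_pos])
    done
  also have "\<dots> = ennreal (tilt_mass \<sigma> y ^ n) * (\<integral>\<^sup>+x. G x \<partial>tilted n \<sigma> y)"
    unfolding h by (subst nn_integral_density) (auto simp: nn_integral_cmult)
  finally show ?thesis .
qed

text \<open>Completing the square in \<open>y\<close>: the integrand is a multiple of the normal
  density with mean \<open>S / T\<close> and variance \<open>1 / T\<close>. The factor
  \<open>sqrt T\<close> compensates its prefactor, so that no power of \<open>T\<close> remains
  outside the exponent.\<close>

lemma nn_integral_gaussian_linearisation:
  assumes T: "0 < T"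
  shows "(\<integral>\<^sup>+y. ennreal (sqrt T * exp (y * S - y\<^sup>2 * T / 2)) \<partial>lborel)
       = ennreal (sqrt (2 * pi) * exp (1 / 2 * (S\<^sup>2 / T)))"
proof -
  have eq: "sqrt T * exp (y * S - y\<^sup>2 * T / 2)
      = sqrt (2 * pi) * exp (1 / 2 * (S\<^sup>2 / T)) * normal_density (S / T) (1 / sqrt T) y" for y
  proof -
    have "y * S - y\<^sup>2 * T / 2 = 1 / 2 * (S\<^sup>2 / T) + - ((y - S / T)\<^sup>2) / (2 * (1 / T))"
      using T by (simp add: field_simps power2_eq_square)
    then have "exp (y * S - y\<^sup>2 * T / 2) = exp (1 / 2 * (S\<^sup>2 / T)) * exp (- ((y - S / T)\<^sup>2) / (2 * (1 / T)))"
      by (simp only: exp_add[symmetric])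
    moreover have "sqrt (2 * pi * (1 / T)) = sqrt (2 * pi) / sqrt T"
      by (simp add: real_sqrt_mult real_sqrt_divide)
    ultimately show ?thesis
      using T by (simp add: normal_density_def power_divide)
  qed
  have "(\<integral>\<^sup>+y. ennreal (normal_density (S / T) (1 / sqrt T) y) \<partial>lborel) = 1"
    using T by (subst nn_integral_eq_integral) auto
  then show ?thesis
    unfolding eq using T by (simp add: ennreal_mult nn_integral_cmult)
qed

text \<open>The linearisation requires \<open>T > 0\<close>. One nonzero coordinate ensures it, and
  the law of a coordinate has no atoms; \<open>n \<ge> 1\<close> guarantees that coordinate 1
  exists.\<close>

lemma AE_gauss_sum_squares_pos:
  fixes n :: nat
  assumes s: "0 < \<sigma>" and n: "1 \<le> n"
  shows "AE x in PiM {1..n} (\<lambda>_. gauss \<sigma>). 0 < (\<Sum>i=1..n. (x i)\<^sup>2)"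
proof -
  have "AE x in gauss \<sigma>. x \<noteq> 0"
    unfolding gauss_def using AE_lborel_singleton[of "0::real"] 
    by (subst AE_density) auto
  then have "AE x in PiM {1..n} (\<lambda>_. gauss \<sigma>). x 1 \<noteq> 0"
    by (intro AE_PiM_component[where M = "\<lambda>_. gauss \<sigma>" and P = "\<lambda>x. x \<noteq> 0"])
      (use n in \<open>simp_all add: prob_space_gauss s\<close>)
  then show ?thesis
  proof eventually_elim
    case (elim x)
    have "0 < (x 1)\<^sup>2" using elim by simp
    also have "\<dots> \<le> (\<Sum>i=1..n. (x i)\<^sup>2)"
      using n by (intro member_le_sum) auto
    finally show ?case .
  qed
qed

text \<open>Linearise \<open>exp (interaction n x)\<close> by an integral over \<open>y\<close>,
  exchange the order of integration by Tonelli's theorem, and absorb the resulting exponential,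
  which factorises over the coordinates, into the tilted law.\<close>

lemma nn_integral_interaction_mixture:
  fixes F :: "(nat \<Rightarrow> real) \<Rightarrow> ennreal"
  assumes s: "0 < \<sigma>" and n: "1 \<le> n" and F: "F \<in> borel_measurable (PiM {1..n} (\<lambda>_. borel))"
  shows "ennreal (sqrt (2 * pi)) * (\<integral>\<^sup>+x. F x * ennreal (exp (interaction n x)) \<partial>PiM {1..n} (\<lambda>_. gauss \<sigma>))
     = (\<integral>\<^sup>+y. ennreal (tilt_mass \<sigma> y ^ n) *
           (\<integral>\<^sup>+x. F x * ennreal (sqrt (\<Sum>i=1..n. (x i)\<^sup>2)) \<partial>tilted n \<sigma> y) \<partial>lborel)"
    (is "_ * ?L = ?R")
    and "(\<lambda>y. ennreal (tilt_mass \<sigma> y ^ n) *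
           (\<integral>\<^sup>+x. F x * ennreal (sqrt (\<Sum>i=1..n. (x i)\<^sup>2)) \<partial>tilted n \<sigma> y)) \<in> borel_measurable borel"
    (is "?f \<in> _")
proof -
  let ?P = "PiM {1..n} (\<lambda>_. gauss \<sigma>)"
  let ?S = "\<lambda>x::nat \<Rightarrow> real. \<Sum>i=1..n. x i" and ?T = "\<lambda>x::nat \<Rightarrow> real. \<Sum>i=1..n. (x i)\<^sup>2"
  interpret P: prob_space ?P by (intro prob_space_PiM prob_space_gauss s)
  interpret pair_sigma_finite ?P "lborel :: real measure" ..
  have setsP: "sets ?P = sets (PiM {1..n} (\<lambda>_. borel :: real measure))"
    by (intro sets_PiM_real) simp
  have FP [measurable]: "F \<in> borel_measurable ?P"
    using F setsP by (simp cong: measurable_cong_sets)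
  let ?g = "\<lambda>x y. F x * ennreal (sqrt (?T x)) * ennreal (exp (y * ?S x - y\<^sup>2 * ?T x / 2))"
  have g [measurable]: "case_prod ?g \<in> borel_measurable (?P \<Otimes>\<^sub>M lborel)"
    by measurable
  have inner: "(\<integral>\<^sup>+x. ?g x y \<partial>?P) = ?f y" for y
    using F by (intro nn_integral_gauss_tilt s) measurable
  have "ennreal (sqrt (2 * pi)) * ?L = (\<integral>\<^sup>+x. F x * ennreal (sqrt (2 * pi) * exp (interaction n x)) \<partial>?P)"
    by (subst nn_integral_cmult[symmetric])
       (auto simp: ennreal_mult interaction_def mult_ac)
  also have "\<dots> = (\<integral>\<^sup>+x. (\<integral>\<^sup>+y. ?g x y \<partial>lborel) \<partial>?P)"
  proof (rule nn_integral_cong_AE)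
    show "AE x in ?P. F x * ennreal (sqrt (2 * pi) * exp (interaction n x)) = (\<integral>\<^sup>+y. ?g x y \<partial>lborel)"
      using AE_gauss_sum_squares_pos[OF s n]
    proof eventually_elim
      case (elim x)
      show ?case
        unfolding interaction_def nn_integral_gaussian_linearisation[OF elim, symmetric]
        using elim by (simp add: nn_integral_cmult[symmetric] ennreal_mult mult.assoc less_imp_le)
    qed
  qed
  also have "\<dots> = (\<integral>\<^sup>+y. (\<integral>\<^sup>+x. ?g x y \<partial>?P) \<partial>lborel)"
    by (rule Fubini'[symmetric]) (rule g)
  finally show "ennreal (sqrt (2 * pi)) * ?L = ?R" by (simp only: inner)
  \<comment> \<open>Measurability in \<open>y\<close> is read off from the untilted side, where the
    integrating measure is fixed and only the integrand depends on \<open>y\<close>.\<close>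
  have "(\<lambda>y. \<integral>\<^sup>+x. ?g x y \<partial>?P) \<in> borel_measurable lborel"
    by measurable
  then show "?f \<in> borel_measurable borel" unfolding inner by simp
qed

section \<open>Moments of sums of independent centred variables\<close>

text \<open>Expanding the square gives a double sum. Off the diagonal, independence and centring
  make every term vanish; the diagonal gives \<open>card I\<close> equal terms.\<close>

lemma second_moment_iid_sum:
  fixes f :: "'a \<Rightarrow> real"
  assumes N: "prob_space N" and I: "finite I"
    and f: "integrable N f" "integrable N (\<lambda>x. (f x)\<^sup>2)" "(\<integral>x. f x \<partial>N) = 0"
  shows "integrable (PiM I (\<lambda>_. N)) (\<lambda>x. (\<Sum>i\<in>I. f (x i))\<^sup>2)"
    and "(\<integral>x. (\<Sum>i\<in>I. f (x i))\<^sup>2 \<partial>PiM I (\<lambda>_. N)) = real (card I) * (\<integral>x. (f x)\<^sup>2 \<partial>N)"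
proof -
  interpret N: prob_space N by fact
  interpret product_sigma_finite "\<lambda>_. N" by (simp add: product_sigma_finite_def N.sigma_finite_measure)
  \<comment> \<open>\<open>u i j\<close> presents \<open>f (x i) * f (x j)\<close> as a product over
    all of \<open>I\<close>, the shape required for integrating coordinatewise; for
    \<open>i = j\<close> both factors fall on the same coordinate and give the square of
    \<open>f\<close>.\<close>
  define u where "u i j k x = (if k = i then f x else 1) * (if k = j then f x else 1)" for i j k :: 'b and x
  have int_u: "integrable N (u i j k)" for i j k
    unfolding u_def using f by (cases "k = i"; cases "k = j") (auto simp: power2_eq_square)
  have u: "(\<Prod>k\<in>I. u i j k (x k)) = f (x i) * f (x j)" if "i \<in> I" "j \<in> I" for i j x
    using that I by (simp add: u_def prod.distrib)
  have int: "integrable (PiM I (\<lambda>_. N)) (\<lambda>x. f (x i) * f (x j))" if "i \<in> I" "j \<in> I" for i j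
    using product_integrable_prod[OF I, of "u i j"] int_u u[OF that] by simp
  have "(\<integral>x. f (x i) * f (x j) \<partial>PiM I (\<lambda>_. N)) = (if i = j then (\<integral>x. (f x)\<^sup>2 \<partial>N) else 0)"
    if "i \<in> I" "j \<in> I" for i j
  proof -
    have "(\<integral>x. f (x i) * f (x j) \<partial>PiM I (\<lambda>_. N)) = (\<Prod>k\<in>I. integral\<^sup>L N (u i j k))"
      using product_integral_prod[OF I, of "u i j"] int_u u[OF that] by simp
    also have "\<dots> = (if i = j then (\<integral>x. (f x)\<^sup>2 \<partial>N) else 0)"
    proof (cases "i = j")
      case True
      then have "(\<Prod>k\<in>I. integral\<^sup>L N (u i j k)) = (\<Prod>k\<in>I. if k = i then (\<integral>x. (f x)\<^sup>2 \<partial>N) else 1)"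
        by (intro prod.cong) (auto simp: u_def[abs_def] power2_eq_square N.prob_space)
      then show ?thesis using True that I by simp
    next
      case False
      then have "integral\<^sup>L N (u i j i) = 0" using f by (simp add: u_def[abs_def])
      then show ?thesis using False that I by (auto simp: prod_zero_iff intro!: bexI[of _ i])
    qed
    finally show ?thesis .
  qed
  note eq = this
  have sq: "(\<Sum>i\<in>I. f (x i))\<^sup>2 = (\<Sum>i\<in>I. \<Sum>j\<in>I. f (x i) * f (x j))" for x
    by (simp add: power2_eq_square sum_product)
  show "integrable (PiM I (\<lambda>_. N)) (\<lambda>x. (\<Sum>i\<in>I. f (x i))\<^sup>2)"
    unfolding sq using int by auto
  show "(\<integral>x. (\<Sum>i\<in>I. f (x i))\<^sup>2 \<partial>PiM I (\<lambda>_. N)) = real (card I) * (\<integral>x. (f x)\<^sup>2 \<partial>N)"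
    unfolding sq using int eq I
    by (simp add: Bochner_Integration.integral_sum)
qed

text \<open>The mean of the absolute value is at most the root of the second moment, because the
  variance of the absolute value is nonnegative.\<close>

lemma L1_iid_sum:
  fixes f :: "'a \<Rightarrow> real"
  assumes N: "prob_space N" and I: "finite I"
    and f: "integrable N f" "integrable N (\<lambda>x. (f x)\<^sup>2)" "(\<integral>x. f x \<partial>N) = 0"
  shows "integrable (PiM I (\<lambda>_. N)) (\<lambda>x. \<Sum>i\<in>I. f (x i))"
    and "(\<integral>x. \<bar>\<Sum>i\<in>I. f (x i)\<bar> \<partial>PiM I (\<lambda>_. N)) \<le> sqrt (real (card I) * (\<integral>x. (f x)\<^sup>2 \<partial>N))"
proof -
  interpret P: prob_space "PiM I (\<lambda>_. N)" by (intro prob_space_PiM N)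
  note sm = second_moment_iid_sum[OF N I f]
  have [measurable]: "f \<in> borel_measurable N" using f(1) by simp
  show int: "integrable (PiM I (\<lambda>_. N)) (\<lambda>x. \<Sum>i\<in>I. f (x i))"
    by (rule P.square_integrable_imp_integrable[OF _ sm(1)]) measurable
  have "0 \<le> P.variance (\<lambda>x. \<bar>\<Sum>i\<in>I. f (x i)\<bar>)" by (rule P.variance_positive)
  then have "(\<integral>x. \<bar>\<Sum>i\<in>I. f (x i)\<bar> \<partial>PiM I (\<lambda>_. N))\<^sup>2 \<le> real (card I) * (\<integral>x. (f x)\<^sup>2 \<partial>N)"
    using int sm by (subst (asm) P.variance_eq) auto
  then show "(\<integral>x. \<bar>\<Sum>i\<in>I. f (x i)\<bar> \<partial>PiM I (\<lambda>_. N)) \<le> sqrt (real (card I) * (\<integral>x. (f x)\<^sup>2 \<partial>N))"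
    by (rule real_le_rsqrt)
qed

subsection \<open>Concentration under normal product laws\<close>

abbreviation normal_measure :: "real \<Rightarrow> real \<Rightarrow> real measure" where
  "normal_measure m s \<equiv> density lborel (\<lambda>x. ennreal (normal_density m s x))"

context
  fixes m s :: real and n :: nat
  assumes s: "0 < s" and n: "1 \<le> n"
begin

lemma prob_space_normal_measure: "prob_space (normal_measure m s)"
  by (rule prob_space_normal_density) (rule s)

lemma normal_central_moments:
  "integrable (normal_measure m s) (\<lambda>x. (x - m) ^ k)"
  "(\<integral>x. x - m \<partial>normal_measure m s) = 0"
  "(\<integral>x. (x - m)\<^sup>2 \<partial>normal_measure m s) = s\<^sup>2"
  "(\<integral>x. (x - m) ^ 4 \<partial>normal_measure m s) = 3 * s ^ 4"
proof -
  show "integrable (normal_measure m s) (\<lambda>x. (x - m) ^ k)"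
    using integrable_normal_moment[OF s, of m k] by (subst integrable_real_density) auto
  show "(\<integral>x. x - m \<partial>normal_measure m s) = 0"
    using integral_normal_moment_odd[OF s, of m 0] by (subst integral_real_density) auto
  show "(\<integral>x. (x - m)\<^sup>2 \<partial>normal_measure m s) = s\<^sup>2"
    using integral_normal_moment_even[OF s, of m 1] by (subst integral_real_density) auto
  show "(\<integral>x. (x - m) ^ 4 \<partial>normal_measure m s) = 3 * s ^ 4"
    using integral_normal_moment_even[OF s, of m 2]
    by (subst integral_real_density) (auto simp: fact_numeral field_simps)
qed

lemma L1_normal_mean:
  shows "integrable (PiM {1..n} (\<lambda>_. normal_measure m s)) (\<lambda>x. (\<Sum>i=1..n. x i) / n - m)"
    and "(\<integral>x. \<bar>(\<Sum>i=1..n. x i) / n - m\<bar> \<partial>PiM {1..n} (\<lambda>_. normal_measure m s)) \<le> s / sqrt n"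
proof -
  note cm = normal_central_moments
  have sq: "integrable (normal_measure m s) (\<lambda>x. (x - m)\<^sup>2)" by (rule cm)
  have int: "integrable (normal_measure m s) (\<lambda>x. x - m)" using cm(1)[of 1] by simp
  note L = L1_iid_sum[OF prob_space_normal_measure finite_atLeastAtMost[of 1 n] int sq cm(2)]
  have eq: "(\<Sum>i=1..n. x i) / n - m = (\<Sum>i=1..n. x i - m) / n" for x :: "nat \<Rightarrow> real"
    using n by (simp add: sum_subtractf field_simps)
  show "integrable (PiM {1..n} (\<lambda>_. normal_measure m s)) (\<lambda>x. (\<Sum>i=1..n. x i) / n - m)"
    unfolding eq by (intro integrable_divide L(1))
  have "(\<integral>x. \<bar>(\<Sum>i=1..n. x i) / n - m\<bar> \<partial>PiM {1..n} (\<lambda>_. normal_measure m s)) = (\<integral>x. \<bar>\<Sum>i=1..n. x i - m\<bar> \<partial>PiM {1..n} (\<lambda>_. normal_measure m s)) / n"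
    unfolding eq by simp
  also have "\<dots> \<le> sqrt (real n * s\<^sup>2) / n"
    using L(2) cm(3) by (intro divide_right_mono) auto
  also have "\<dots> = s / sqrt n"
    using s n by (simp add: real_sqrt_mult field_simps)
  finally show "(\<integral>x. \<bar>(\<Sum>i=1..n. x i) / n - m\<bar> \<partial>PiM {1..n} (\<lambda>_. normal_measure m s)) \<le> s / sqrt n" .
qed

text \<open>Split \<open>x_i^2 - (m^2 + s^2)\<close> into \<open>2 * m * (x_i - m)\<close> and
  \<open>(x_i - m)^2 - s^2\<close>, both centred. The first is handled by
  \<open>L1_normal_mean\<close>; the second has second moment
  \<open>3 * s^4 - 2 * s^4 + s^4 = 2 * s^4\<close>, whence the term with
  \<open>sqrt 2\<close>.\<close>

lemma L1_normal_square_mean: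
  shows "integrable (PiM {1..n} (\<lambda>_. normal_measure m s)) (\<lambda>x. (\<Sum>i=1..n. (x i)\<^sup>2) / n - (m\<^sup>2 + s\<^sup>2))"
    and "(\<integral>x. \<bar>(\<Sum>i=1..n. (x i)\<^sup>2) / n - (m\<^sup>2 + s\<^sup>2)\<bar> \<partial>PiM {1..n} (\<lambda>_. normal_measure m s))
       \<le> 2 * \<bar>m\<bar> * (s / sqrt n) + sqrt 2 * s\<^sup>2 / sqrt n"
proof -
  interpret N: prob_space "normal_measure m s" by (rule prob_space_normal_measure)
  note cm = normal_central_moments
  have int: "integrable (normal_measure m s) (\<lambda>x. (x - m)\<^sup>2 - s\<^sup>2)" using cm(1)[of 2] by auto
  have eq2: "((x - m)\<^sup>2 - s\<^sup>2)\<^sup>2 = (x - m) ^ 4 - 2 * s\<^sup>2 * (x - m)\<^sup>2 + s ^ 4" for x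
    by algebra
  have sq: "integrable (normal_measure m s) (\<lambda>x. ((x - m)\<^sup>2 - s\<^sup>2)\<^sup>2)"
    unfolding eq2 by (intro Bochner_Integration.integrable_add Bochner_Integration.integrable_diff integrable_mult_right cm) auto
  have z: "(\<integral>x. (x - m)\<^sup>2 - s\<^sup>2 \<partial>normal_measure m s) = 0"
    using cm(1)[of 2] cm(3) N.prob_space by simp
  have v: "(\<integral>x. ((x - m)\<^sup>2 - s\<^sup>2)\<^sup>2 \<partial>normal_measure m s) = 2 * s ^ 4"
    unfolding eq2 using cm(1)[of 2] cm(1)[of 4] cm(3,4) N.prob_space
    by (simp add: power2_eq_square power4_eq_xxxx)
  note L = L1_iid_sum[OF prob_space_normal_measure finite_atLeastAtMost[of 1 n] int sq z]
  have eq: "(\<Sum>i=1..n. (x i)\<^sup>2) / n - (m\<^sup>2 + s\<^sup>2)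
      = 2 * m * ((\<Sum>i=1..n. x i) / n - m) + (\<Sum>i=1..n. (x i - m)\<^sup>2 - s\<^sup>2) / n" for x :: "nat \<Rightarrow> real"
  proof -
    have e: "(\<Sum>i=1..n. (x i - m)\<^sup>2 - s\<^sup>2) = (\<Sum>i=1..n. (x i)\<^sup>2) - 2 * m * (\<Sum>i=1..n. x i) + n * m\<^sup>2 - n * s\<^sup>2"
      by (simp add: power2_diff sum_subtractf sum.distrib sum_distrib_left mult_ac)
    show ?thesis unfolding e using n by (simp add: field_simps power2_eq_square)
  qed
  have i1: "integrable (PiM {1..n} (\<lambda>_. normal_measure m s)) (\<lambda>x. 2 * m * ((\<Sum>i=1..n. x i) / n - m))"
    by (intro integrable_mult_right L1_normal_mean)
  have i2: "integrable (PiM {1..n} (\<lambda>_. normal_measure m s)) (\<lambda>x. (\<Sum>i=1..n. (x i - m)\<^sup>2 - s\<^sup>2) / n)"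
    by (intro integrable_divide L)
  show i3: "integrable (PiM {1..n} (\<lambda>_. normal_measure m s)) (\<lambda>x. (\<Sum>i=1..n. (x i)\<^sup>2) / n - (m\<^sup>2 + s\<^sup>2))"
    unfolding eq using i1 i2 by (rule Bochner_Integration.integrable_add)
  have "(\<integral>x. \<bar>(\<Sum>i=1..n. (x i)\<^sup>2) / n - (m\<^sup>2 + s\<^sup>2)\<bar> \<partial>PiM {1..n} (\<lambda>_. normal_measure m s))
      \<le> (\<integral>x. \<bar>2 * m * ((\<Sum>i=1..n. x i) / n - m)\<bar> + \<bar>(\<Sum>i=1..n. (x i - m)\<^sup>2 - s\<^sup>2) / n\<bar> \<partial>PiM {1..n} (\<lambda>_. normal_measure m s))"
    unfolding eq using i1 i2 by (intro integral_mono integrable_abs Bochner_Integration.integrable_add abs_triangle_ineq)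
  also have "\<dots> = (\<integral>x. \<bar>2 * m * ((\<Sum>i=1..n. x i) / n - m)\<bar> \<partial>PiM {1..n} (\<lambda>_. normal_measure m s))
      + (\<integral>x. \<bar>(\<Sum>i=1..n. (x i - m)\<^sup>2 - s\<^sup>2) / n\<bar> \<partial>PiM {1..n} (\<lambda>_. normal_measure m s))"
    using i1 i2 by (intro Bochner_Integration.integral_add integrable_abs)
  also have "(\<integral>x. \<bar>2 * m * ((\<Sum>i=1..n. x i) / n - m)\<bar> \<partial>PiM {1..n} (\<lambda>_. normal_measure m s))
      = 2 * \<bar>m\<bar> * (\<integral>x. \<bar>(\<Sum>i=1..n. x i) / n - m\<bar> \<partial>PiM {1..n} (\<lambda>_. normal_measure m s))"
    by (simp add: abs_mult)
  also have "\<dots> \<le> 2 * \<bar>m\<bar> * (s / sqrt n)"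
    by (intro mult_left_mono L1_normal_mean) auto
  also have "(\<integral>x. \<bar>(\<Sum>i=1..n. (x i - m)\<^sup>2 - s\<^sup>2) / n\<bar> \<partial>PiM {1..n} (\<lambda>_. normal_measure m s))
      = (\<integral>x. \<bar>\<Sum>i=1..n. (x i - m)\<^sup>2 - s\<^sup>2\<bar> \<partial>PiM {1..n} (\<lambda>_. normal_measure m s)) / n"
    by simp
  also have "\<dots> \<le> sqrt (real n * (2 * s ^ 4)) / n"
    using L(2) v by (intro divide_right_mono) auto
  also have "sqrt (real n * (2 * s ^ 4)) / n = sqrt 2 * s\<^sup>2 / sqrt n"
  proof -
    have "sqrt (s ^ 4) = s\<^sup>2"
      by (rule real_sqrt_unique) auto
    then show ?thesis using n by (simp add: real_sqrt_mult field_simps)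
  qed
  finally show "(\<integral>x. \<bar>(\<Sum>i=1..n. (x i)\<^sup>2) / n - (m\<^sup>2 + s\<^sup>2)\<bar> \<partial>PiM {1..n} (\<lambda>_. normal_measure m s))
       \<le> 2 * \<bar>m\<bar> * (s / sqrt n) + sqrt 2 * s\<^sup>2 / sqrt n" by simp
qed

end

subsection \<open>Asymptotics of the mixture\<close>

text \<open>The exponent \<open>1 / 4\<close> meets two requirements at once:
  \<open>n * \<sigma>^2 * y\<close>, the leading part of the mean of \<open>S\<close>, equals
  \<open>x * n powr (3 / 4)\<close>, and \<open>n * \<sigma>^4 * y^4 / 4\<close> equals
  \<open>x^4 / (4 * \<sigma>^4)\<close>, free of \<open>n\<close>.\<close>

definition tilt_scale :: "real \<Rightarrow> real \<Rightarrow> nat \<Rightarrow> real" where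
  "tilt_scale \<sigma> x n = x / (\<sigma>\<^sup>2 * real n powr (1 / 4))"

lemma tilt_scale_square:
  assumes "0 < \<sigma>" 
  shows "\<sigma>\<^sup>2 * (tilt_scale \<sigma> x n)\<^sup>2 = x\<^sup>2 / \<sigma>\<^sup>2 / sqrt n"
proof -
  have "(real n powr (1 / 4))\<^sup>2 = sqrt n"
    by (cases "n = 0") (auto simp: powr_half_sqrt[symmetric] power2_eq_square powr_add[symmetric])
  then have "(tilt_scale \<sigma> x n)\<^sup>2 = x\<^sup>2 / (\<sigma> ^ 4 * sqrt n)"
    by (simp add: tilt_scale_def power_divide power_mult_distrib)
  then show ?thesis
    using assms by (simp add: field_simps power4_eq_xxxx power2_eq_square)
qed

text \<open>\<open>tilt_mass\<close> depends on \<open>y\<close> only through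
  \<open>w = \<sigma>^2 * y^2\<close>, and minus twice its logarithm is
  \<open>ln (1 + w) - w / (1 + w)\<close>. Both the limit and the domination are read off from this
  form.\<close>

lemma tilt_mass_power:
  assumes "0 < \<sigma>"
  shows "tilt_mass \<sigma> (tilt_scale \<sigma> x n) ^ n
    = exp (- (n * (ln (1 + x\<^sup>2 / \<sigma>\<^sup>2 / sqrt n) - (x\<^sup>2 / \<sigma>\<^sup>2 / sqrt n) / (1 + x\<^sup>2 / \<sigma>\<^sup>2 / sqrt n)) / 2))"
proof -
  define w where "w = x\<^sup>2 / \<sigma>\<^sup>2 / sqrt n"
  have w: "0 \<le> w" by (simp add: w_def)
  have "tilt_mass \<sigma> (tilt_scale \<sigma> x n) = exp (w / (2 * (1 + w))) / sqrt (1 + w)"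
    unfolding tilt_mass_def tilt_scale_square[OF assms] w_def[symmetric] ..
  also have "sqrt (1 + w) = exp (ln (1 + w) / 2)"
    using w by (simp add: powr_half_sqrt[symmetric] powr_def)
  finally have "tilt_mass \<sigma> (tilt_scale \<sigma> x n) = exp (- ((ln (1 + w) - w / (1 + w)) / 2))"
    using w by (simp add: exp_diff[symmetric] field_simps)
  then show ?thesis
    unfolding w_def[symmetric] by (simp add: exp_of_nat_mult[symmetric] algebra_simps)
qed

text \<open>As \<open>w\<close> tends to 0, \<open>ln (1 + w) - w / (1 + w)\<close> is
  \<open>w^2 / 2\<close> up to higher order, the linear terms cancelling. With
  \<open>w = u / sqrt n\<close> the exponent therefore tends to \<open>- u^2 / 4\<close>.\<close>

lemma tilt_mass_power_tendsto:
  assumes s: "0 < \<sigma>"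
  shows "(\<lambda>n. tilt_mass \<sigma> (tilt_scale \<sigma> x n) ^ n) \<longlonglongrightarrow> exp (- (x ^ 4) / (4 * \<sigma> ^ 4))"
proof -
  define u where "u = x\<^sup>2 / \<sigma>\<^sup>2"
  have "(\<lambda>n. exp (- (real n * (ln (1 + u / sqrt n) - (u / sqrt n) / (1 + u / sqrt n)) / 2))) \<longlonglongrightarrow> exp (- (u * u / 4))"
  proof (cases "u = 0")
    case False
    then have "0 < u" by (simp add: u_def)
    then show ?thesis by real_asymp
  qed simp
  moreover have "- (u * u / 4) = - (x ^ 4) / (4 * \<sigma> ^ 4)"
    by (simp add: u_def power4_eq_xxxx power2_eq_square)
  ultimately show ?thesis
    unfolding tilt_mass_power[OF s] u_def by (simp add: mult.commute)
qed

text \<open>The derivative in \<open>u = x\<^sup>2 / \<sigma>\<^sup>2\<close> of \<open>n * h (u / sqrt n)\<close>, where \<open>h w = ln (1 + w) - w / (1 + w)\<close>,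
  is \<open>u / (1 + u / sqrt n)\<^sup>2\<close>, which increases with \<open>n\<close>; so the term \<open>n = 4\<close> dominates.\<close>

lemma tilt_mass_power_le:
  assumes s: "0 < \<sigma>" and n: "4 \<le> n"
  shows "tilt_mass \<sigma> (tilt_scale \<sigma> x n) ^ n \<le> exp 2 / (1 + x\<^sup>2 / (2 * \<sigma>\<^sup>2))"
proof -
  define u where "u = x\<^sup>2 / \<sigma>\<^sup>2"
  have u: "0 \<le> u" by (simp add: u_def)
  define k where "k = sqrt n"
  have k2: "2 \<le> k" using n real_sqrt_le_mono[of 4 n] by (simp add: k_def)
  have kn: "real n = k\<^sup>2" by (simp add: k_def)
  \<comment> \<open>The real parameter \<open>k\<close> stands for \<open>sqrt n\<close>, so that
    \<open>g k v\<close> is \<open>n * h (v / sqrt n)\<close> and the case \<open>n = 4\<close> is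
    \<open>g 2\<close>.\<close>
  define g where "g k v = k\<^sup>2 * (ln (1 + v / k) - (v / k) / (1 + v / k))" for k v :: real
  have dg: "((\<lambda>v. g k v) has_real_derivative v / (1 + v / k)\<^sup>2) (at v)" if "0 \<le> v" "2 \<le> k" for k v :: real
  proof -
    have p: "0 < 1 + v / k" using that by (simp add: add_pos_nonneg)
    show ?thesis
      unfolding g_def
      apply (rule derivative_eq_intros refl | use p that in force)+
      using p that by (simp add: divide_simps) (simp add: algebra_simps power2_eq_square)
  qed
  have "g 2 u \<le> g k u"
  proof -
    \<comment> \<open>Both functions vanish at 0, and the derivative of \<open>g k\<close> is the
      larger one on \<open>[0, u]\<close>.\<close>
    have "(\<lambda>v. g k v - g 2 v) 0 \<le> (\<lambda>v. g k v - g 2 v) u"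
    proof (rule DERIV_nonneg_imp_nondecreasing[OF u])
      fix v :: real assume v: "0 \<le> v" "v \<le> u"
      have "v / (1 + v / 2)\<^sup>2 \<le> v / (1 + v / k)\<^sup>2"
        using v k2 by (intro divide_left_mono power_mono mult_pos_pos zero_less_power add_left_mono)
          (auto intro!: add_nonneg_nonneg add_pos_nonneg divide_left_mono)
      then show "\<exists>y. ((\<lambda>v. g k v - g 2 v) has_real_derivative y) (at v) \<and> 0 \<le> y"
        using DERIV_diff[OF dg[OF v(1) k2] dg[OF v(1), of 2]] by (intro exI conjI) auto
    qed
    then show ?thesis by (simp add: g_def)
  qed
  have "tilt_mass \<sigma> (tilt_scale \<sigma> x n) ^ n = exp (- (g k u / 2))"
    unfolding tilt_mass_power[OF s] g_def kn u_def[symmetric] using k2 by simp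
  also have "\<dots> \<le> exp (- (g 2 u / 2))"
    using \<open>g 2 u \<le> g k u\<close> by simp
  also have "\<dots> = exp (2 * ((u / 2) / (1 + u / 2))) / (1 + u / 2)\<^sup>2"
  proof -
    define q where "q = (u / 2) / (1 + u / 2)"
    have "- (g 2 u / 2) = 2 * q - 2 * ln (1 + u / 2)"
      unfolding g_def q_def[symmetric] by (simp add: diff_divide_distrib)
    then have "- (g 2 u / 2) = 2 * ((u / 2) / (1 + u / 2)) - 2 * ln (1 + u / 2)"
      by (simp only: q_def)
    moreover have "exp (2 * ln (1 + u / 2)) = (1 + u / 2)\<^sup>2"
      using u by (subst exp_double) simp
    ultimately show ?thesis by (simp only: exp_diff)
  qed
  \<comment> \<open>The exponent is at most 2, as \<open>(u / 2) / (1 + u / 2) \<le> 1\<close>. One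
    of the two factors \<open>1 + u / 2\<close> is given up; the reciprocal of the other decays like
    \<open>1 / x^2\<close>, which suffices for integrability.\<close>
  also have "\<dots> \<le> exp 2 / (1 + u / 2)"
  proof (rule frac_le)
    show "1 + u / 2 \<le> (1 + u / 2)\<^sup>2" using u by (intro self_le_power) auto
  qed (use u in \<open>auto simp: divide_simps\<close>)
  finally show ?thesis by (simp add: u_def mult.commute)
qed

lemma tilt_scale_tendsto: "0 < \<sigma> \<Longrightarrow> (\<lambda>n. tilt_scale \<sigma> x n) \<longlonglongrightarrow> 0"
  unfolding tilt_scale_def by real_asymp

text \<open>With \<open>w = \<sigma>^2 * y^2\<close> the two terms are
  \<open>\<sigma>^2 * w / (1 + w)^2\<close> and \<open>\<sigma>^2 / (1 + w)\<close>. Uniformity in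
  \<open>y\<close> serves the domination, where \<open>y\<close> ranges over the whole line.\<close>

lemma tilt_second_moment_le:
  assumes "0 < \<sigma>" shows "(tilt_mean \<sigma> y)\<^sup>2 + (tilt_sd \<sigma> y)\<^sup>2 \<le> 2 * \<sigma>\<^sup>2"
proof -
  define w where "w = \<sigma>\<^sup>2 * y\<^sup>2"
  have w: "0 \<le> w" by (simp add: w_def)
  have "(tilt_mean \<sigma> y)\<^sup>2 = \<sigma>\<^sup>2 * (w / (1 + w)\<^sup>2)"
    by (simp add: tilt_mean_def w_def power_divide power_mult_distrib power2_eq_square)
  also have "w / (1 + w)\<^sup>2 \<le> 1"
    using w by (simp add: divide_simps power2_eq_square algebra_simps)
  moreover have "(tilt_sd \<sigma> y)\<^sup>2 = \<sigma>\<^sup>2 * (1 / (1 + w))"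
    using w by (simp add: tilt_sd_def w_def[symmetric] power_divide)
  moreover have "1 / (1 + w) \<le> 1" using w by simp
  ultimately show ?thesis
    using mult_left_mono[of "w / (1 + w)\<^sup>2" 1 "\<sigma>\<^sup>2"] mult_left_mono[of "1 / (1 + w)" 1 "\<sigma>\<^sup>2"] by simp
qed

section \<open>Concentration of \<open>S\<close> and \<open>T\<close> under the tilted laws\<close>

context
  fixes \<sigma> :: real
  assumes s: "0 < \<sigma>"
begin

lemma tilt_params_tendsto:
  "(\<lambda>n. tilt_mean \<sigma> (tilt_scale \<sigma> x n)) \<longlonglongrightarrow> 0"
  "(\<lambda>n. tilt_sd \<sigma> (tilt_scale \<sigma> x n)) \<longlonglongrightarrow> \<sigma>"
proof -
  note t = tilt_scale_tendsto[OF s, of x]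
  have "(\<lambda>n. tilt_mean \<sigma> (tilt_scale \<sigma> x n)) \<longlonglongrightarrow> \<sigma>\<^sup>2 * 0 / (1 + \<sigma>\<^sup>2 * 0\<^sup>2)"
    unfolding tilt_mean_def by (intro tendsto_intros t) auto
  then show "(\<lambda>n. tilt_mean \<sigma> (tilt_scale \<sigma> x n)) \<longlonglongrightarrow> 0" by simp
  have "(\<lambda>n. tilt_sd \<sigma> (tilt_scale \<sigma> x n)) \<longlonglongrightarrow> \<sigma> / sqrt (1 + \<sigma>\<^sup>2 * 0\<^sup>2)"
    unfolding tilt_sd_def by (intro tendsto_intros t) auto
  then show "(\<lambda>n. tilt_sd \<sigma> (tilt_scale \<sigma> x n)) \<longlonglongrightarrow> \<sigma>" by simp
qed

text \<open>The centre \<open>c\<close> is free because two values occur: \<open>\<sigma>^2\<close>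
  gives the convergence of \<open>T / n\<close>, and \<open>0\<close> gives a bound on its
  mean.\<close>

lemma L1_square_mean_tilted:
  assumes "1 \<le> n"
  shows "integrable (tilted n \<sigma> y) (\<lambda>x. (\<Sum>i=1..n. (x i)\<^sup>2) / n - c)"
    and "(\<integral>x. \<bar>(\<Sum>i=1..n. (x i)\<^sup>2) / n - c\<bar> \<partial>tilted n \<sigma> y)
     \<le> 2 * \<bar>tilt_mean \<sigma> y\<bar> * (tilt_sd \<sigma> y / sqrt n) + sqrt 2 * (tilt_sd \<sigma> y)\<^sup>2 / sqrt n
        + \<bar>(tilt_mean \<sigma> y)\<^sup>2 + (tilt_sd \<sigma> y)\<^sup>2 - c\<bar>"
proof -
  interpret P: prob_space "tilted n \<sigma> y" by (intro prob_space_PiM prob_space_tilted_gauss s)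
  let ?v = "(tilt_mean \<sigma> y)\<^sup>2 + (tilt_sd \<sigma> y)\<^sup>2"
  note L = L1_normal_square_mean[where m = "tilt_mean \<sigma> y", OF tilt_sd_pos[OF s] assms, of y, folded tilted_gauss_def]
  have eq: "(\<Sum>i=1..n. (x i)\<^sup>2) / n - c = ((\<Sum>i=1..n. (x i)\<^sup>2) / n - ?v) + (?v - c)" for x
    by simp
  show i: "integrable (tilted n \<sigma> y) (\<lambda>x. (\<Sum>i=1..n. (x i)\<^sup>2) / n - c)"
    unfolding eq using L(1) by (rule Bochner_Integration.integrable_add) simp
  have "(\<integral>x. \<bar>(\<Sum>i=1..n. (x i)\<^sup>2) / n - c\<bar> \<partial>tilted n \<sigma> y)
     \<le> (\<integral>x. \<bar>(\<Sum>i=1..n. (x i)\<^sup>2) / n - ?v\<bar> + \<bar>?v - c\<bar> \<partial>tilted n \<sigma> y)"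
    by (intro integral_mono integrable_abs i Bochner_Integration.integrable_add L(1)) auto
  also have "\<dots> = (\<integral>x. \<bar>(\<Sum>i=1..n. (x i)\<^sup>2) / n - ?v\<bar> \<partial>tilted n \<sigma> y) + \<bar>?v - c\<bar>"
    using L(1) by (subst Bochner_Integration.integral_add) (auto simp: P.prob_space)
  finally show "(\<integral>x. \<bar>(\<Sum>i=1..n. (x i)\<^sup>2) / n - c\<bar> \<partial>tilted n \<sigma> y)
     \<le> 2 * \<bar>tilt_mean \<sigma> y\<bar> * (tilt_sd \<sigma> y / sqrt n) + sqrt 2 * (tilt_sd \<sigma> y)\<^sup>2 / sqrt n
        + \<bar>?v - c\<bar>" using L(2) by simp
qed

lemma square_mean_tilted_tendsto:
  "(\<lambda>n. \<integral>z. \<bar>(\<Sum>i=1..n. (z i)\<^sup>2) / n - \<sigma>\<^sup>2\<bar> \<partial>tilted n \<sigma> (tilt_scale \<sigma> x n)) \<longlonglongrightarrow> 0"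
proof (rule tendsto_sandwich[OF _ _ tendsto_const])
  let ?m = "\<lambda>n. tilt_mean \<sigma> (tilt_scale \<sigma> x n)" and ?s = "\<lambda>n. tilt_sd \<sigma> (tilt_scale \<sigma> x n)"
  let ?b = "\<lambda>n. 2 * \<bar>?m n\<bar> * (?s n * (1 / sqrt n)) + sqrt 2 * (?s n)\<^sup>2 * (1 / sqrt n) + \<bar>(?m n)\<^sup>2 + (?s n)\<^sup>2 - \<sigma>\<^sup>2\<bar>"
  show "\<forall>\<^sub>F n in sequentially. 0 \<le> (\<integral>z. \<bar>(\<Sum>i=1..n. (z i)\<^sup>2) / n - \<sigma>\<^sup>2\<bar> \<partial>tilted n \<sigma> (tilt_scale \<sigma> x n))"
    by (intro always_eventually) auto
  show "\<forall>\<^sub>F n in sequentially. (\<integral>z. \<bar>(\<Sum>i=1..n. (z i)\<^sup>2) / n - \<sigma>\<^sup>2\<bar> \<partial>tilted n \<sigma> (tilt_scale \<sigma> x n)) \<le> ?b n"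
    using eventually_ge_at_top[of 1]
    by eventually_elim (use L1_square_mean_tilted(2) in simp)
  have r: "(\<lambda>n. 1 / sqrt (real n)) \<longlonglongrightarrow> 0" by real_asymp
  have "?b \<longlonglongrightarrow> 2 * \<bar>0\<bar> * (\<sigma> * 0) + sqrt 2 * \<sigma>\<^sup>2 * 0 + \<bar>0\<^sup>2 + \<sigma>\<^sup>2 - \<sigma>\<^sup>2\<bar>"
    by (intro tendsto_intros tilt_params_tendsto r)
  then show "?b \<longlonglongrightarrow> 0" by simp
qed

text \<open>With \<open>r = n powr (1 / 4)\<close> and \<open>m\<close> the tilted mean, the
  deviation is \<open>r * (S / n - m) + (r * m - x)\<close>. The fluctuation is of order
  \<open>r / sqrt n = n powr (- 1 / 4)\<close>, and the bias vanishes because \<open>y\<close> tends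
  to 0.\<close>

lemma sum_tilted_tendsto:
  "(\<lambda>n. \<integral>z. \<bar>(\<Sum>i=1..n. z i) / real n powr (3 / 4) - x\<bar> \<partial>tilted n \<sigma> (tilt_scale \<sigma> x n)) \<longlonglongrightarrow> 0"
proof (rule tendsto_sandwich[OF _ _ tendsto_const])
  let ?m = "\<lambda>n. tilt_mean \<sigma> (tilt_scale \<sigma> x n)" and ?s = "\<lambda>n. tilt_sd \<sigma> (tilt_scale \<sigma> x n)"
  let ?P = "\<lambda>n. tilted n \<sigma> (tilt_scale \<sigma> x n)"
  let ?b = "\<lambda>n. ?s n * real n powr (- 1 / 4) + \<bar>x / (1 + \<sigma>\<^sup>2 * (tilt_scale \<sigma> x n)\<^sup>2) - x\<bar>"
  show "\<forall>\<^sub>F n in sequentially. 0 \<le> (\<integral>z. \<bar>(\<Sum>i=1..n. z i) / real n powr (3 / 4) - x\<bar> \<partial>?P n)"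
    by (intro always_eventually) auto
  show "\<forall>\<^sub>F n in sequentially. (\<integral>z. \<bar>(\<Sum>i=1..n. z i) / real n powr (3 / 4) - x\<bar> \<partial>?P n) \<le> ?b n"
    using eventually_ge_at_top[of 1]
  proof eventually_elim
    case n: (elim n)
    interpret P: prob_space "?P n" by (intro prob_space_PiM prob_space_tilted_gauss s)
    define r where "r = real n powr (1 / 4)"
    have r: "0 < r" using n by (simp add: r_def)
    have r3: "real n powr (3 / 4) = real n / r"
      using n by (simp add: r_def powr_diff[symmetric, of "real n" 1 "1/4", simplified])
    have r1: "r / sqrt n = real n powr (- 1 / 4)"
      using n by (simp add: r_def powr_half_sqrt[symmetric] powr_diff[symmetric])
    \<comment> \<open>\<open>r * \<sigma>^2 * y = x\<close> by the choice of
      \<open>tilt_scale\<close>, so only the denominator of \<open>tilt_mean\<close>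
      remains.\<close>
    have rm: "r * ?m n = x / (1 + \<sigma>\<^sup>2 * (tilt_scale \<sigma> x n)\<^sup>2)"
      using r s by (simp add: tilt_mean_def tilt_scale_def r_def[symmetric])
    note L = L1_normal_mean[where m = "?m n", OF tilt_sd_pos[OF s] n, of "tilt_scale \<sigma> x n", folded tilted_gauss_def]
    have eq: "(\<Sum>i=1..n. z i) / real n powr (3 / 4) - x = r * ((\<Sum>i=1..n. z i) / n - ?m n) + (r * ?m n - x)" for z
      using r by (simp add: r3 algebra_simps)
    have "(\<integral>z. \<bar>(\<Sum>i=1..n. z i) / real n powr (3 / 4) - x\<bar> \<partial>?P n)
        \<le> (\<integral>z. r * \<bar>(\<Sum>i=1..n. z i) / n - ?m n\<bar> + \<bar>r * ?m n - x\<bar> \<partial>?P n)"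
    proof (intro integral_mono)
      show "integrable (?P n) (\<lambda>z. \<bar>(\<Sum>i=1..n. z i) / real n powr (3 / 4) - x\<bar>)"
        unfolding eq
        by (intro integrable_abs Bochner_Integration.integrable_add integrable_mult_right L(1)) (simp_all add: L(1))
      show "integrable (?P n) (\<lambda>z. r * \<bar>(\<Sum>i=1..n. z i) / n - ?m n\<bar> + \<bar>r * ?m n - x\<bar>)"
        by (intro integrable_abs Bochner_Integration.integrable_add integrable_mult_right L(1)) (simp_all)
      show "\<bar>(\<Sum>i=1..n. z i) / real n powr (3 / 4) - x\<bar> \<le> r * \<bar>(\<Sum>i=1..n. z i) / n - ?m n\<bar> + \<bar>r * ?m n - x\<bar>" for z
        unfolding eq using r abs_triangle_ineq[of "r * ((\<Sum>i=1..n. z i) / n - ?m n)" "r * ?m n - x"]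
        by (simp add: abs_mult)
    qed
    also have "\<dots> = r * (\<integral>z. \<bar>(\<Sum>i=1..n. z i) / n - ?m n\<bar> \<partial>?P n) + \<bar>r * ?m n - x\<bar>"
      using L(1) by (subst Bochner_Integration.integral_add) (auto simp: P.prob_space)
    also have "\<dots> \<le> r * (?s n / sqrt n) + \<bar>r * ?m n - x\<bar>"
      using r L(2) by (intro add_right_mono mult_left_mono) auto
    also have "\<dots> = ?b n" unfolding rm r1[symmetric] by simp
    finally show ?case .
  qed
  have r: "(\<lambda>n. real n powr (- 1 / 4)) \<longlonglongrightarrow> 0" by real_asymp
  have "?b \<longlonglongrightarrow> \<sigma> * 0 + \<bar>x / (1 + \<sigma>\<^sup>2 * 0\<^sup>2) - x\<bar>"
    by (intro tendsto_intros tilt_params_tendsto r tilt_scale_tendsto s) auto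
  then show "?b \<longlonglongrightarrow> 0" by simp
qed

text \<open>Under the tilted laws \<open>F\<close> is close to \<open>c\<close> and
  \<open>sqrt (T / n)\<close> is close to \<open>\<sigma>\<close>, both in mean; since
  \<open>F\<close> is bounded by 1, the error of the product is controlled by the sum of the two
  errors.\<close>

lemma weighted_tilted_tendsto:
  fixes F :: "nat \<Rightarrow> (nat \<Rightarrow> real) \<Rightarrow> real"
  assumes F: "\<And>n. F n \<in> borel_measurable (PiM {1..n} (\<lambda>_. borel))" "\<And>n z. 0 \<le> F n z" "\<And>n z. F n z \<le> 1"
    and lim: "(\<lambda>n. \<integral>z. \<bar>F n z - c\<bar> \<partial>tilted n \<sigma> (tilt_scale \<sigma> x n)) \<longlonglongrightarrow> 0"
  shows "(\<lambda>n. \<integral>z. F n z * sqrt ((\<Sum>i=1..n. (z i)\<^sup>2) / n) \<partial>tilted n \<sigma> (tilt_scale \<sigma> x n)) \<longlonglongrightarrow> \<sigma> * c"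
proof (rule Lim_transform[OF tendsto_const], rule Lim_null_comparison)
  let ?P = "\<lambda>n. tilted n \<sigma> (tilt_scale \<sigma> x n)"
  let ?T = "\<lambda>n z. (\<Sum>i=1..n. (z i)\<^sup>2) / real n :: real"
  let ?b = "\<lambda>n. (\<integral>z. \<bar>?T n z - \<sigma>\<^sup>2\<bar> \<partial>?P n) / \<sigma> + \<sigma> * (\<integral>z. \<bar>F n z - c\<bar> \<partial>?P n)"
  have "?b \<longlonglongrightarrow> 0 / \<sigma> + \<sigma> * 0"
    using s by (intro tendsto_intros lim square_mean_tilted_tendsto) auto
  then show "?b \<longlonglongrightarrow> 0" by simp
  show "\<forall>\<^sub>F n in sequentially. norm ((\<integral>z. F n z * sqrt (?T n z) \<partial>?P n) - \<sigma> * c) \<le> ?b n"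
    using eventually_ge_at_top[of 1]
  proof eventually_elim
    case n: (elim n)
    interpret P: prob_space "?P n" by (intro prob_space_PiM prob_space_tilted_gauss s)
    have setsP: "sets (?P n) = sets (PiM {1..n} (\<lambda>_. borel :: real measure))"
      by (intro sets_PiM_real) simp
    have [measurable]: "F n \<in> borel_measurable (?P n)"
      using F(1) setsP by (simp cong: measurable_cong_sets)
    have iT: "integrable (?P n) (\<lambda>z. \<bar>?T n z - \<sigma>\<^sup>2\<bar> / \<sigma>)"
      using L1_square_mean_tilted[OF n] by (intro integrable_divide integrable_abs)
    have iF: "integrable (?P n) (\<lambda>z. \<sigma> * \<bar>F n z - c\<bar>)"
    proof -
      have "integrable (?P n) (F n)"
        using F(2,3)[of n] by (intro P.integrable_const_bound[where B = 1]) (auto)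
      then show ?thesis
        by (intro integrable_mult_right integrable_abs Bochner_Integration.integrable_diff) (auto)
    qed
    have pw: "\<bar>F n z * sqrt (?T n z) - \<sigma> * c\<bar> \<le> \<bar>?T n z - \<sigma>\<^sup>2\<bar> / \<sigma> + \<sigma> * \<bar>F n z - c\<bar>" for z
    proof -
      let ?q = "sqrt (?T n z)"
      have q: "0 \<le> ?q" "?q\<^sup>2 = ?T n z" by (auto intro!: sum_nonneg divide_nonneg_nonneg)
      \<comment> \<open>As \<open>?q + \<sigma> \<ge> \<sigma>\<close>, the difference of squares
        bounds the difference of the roots at the price of a division by
        \<open>\<sigma>\<close>.\<close>
      have "\<sigma> * \<bar>?q - \<sigma>\<bar> \<le> (?q + \<sigma>) * \<bar>?q - \<sigma>\<bar>" using q by (intro mult_right_mono) auto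
      also have "\<dots> = \<bar>(?q + \<sigma>) * (?q - \<sigma>)\<bar>" using q s by (simp add: abs_mult)
      also have "(?q + \<sigma>) * (?q - \<sigma>) = ?T n z - \<sigma>\<^sup>2" using q by (simp add: algebra_simps power2_eq_square)
      finally have "\<bar>?q - \<sigma>\<bar> \<le> \<bar>?T n z - \<sigma>\<^sup>2\<bar> / \<sigma>" using s by (simp add: pos_le_divide_eq mult.commute)
      moreover have "\<bar>F n z * ?q - \<sigma> * c\<bar> \<le> F n z * \<bar>?q - \<sigma>\<bar> + \<sigma> * \<bar>F n z - c\<bar>"
      proof -
        have "F n z * ?q - \<sigma> * c = F n z * (?q - \<sigma>) + \<sigma> * (F n z - c)" by (simp add: algebra_simps)
        then show ?thesis
          using abs_triangle_ineq[of "F n z * (?q - \<sigma>)" "\<sigma> * (F n z - c)"] F(2) s by (simp add: abs_mult)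
      qed
      moreover have "F n z * \<bar>?q - \<sigma>\<bar> \<le> 1 * \<bar>?q - \<sigma>\<bar>" using F by (intro mult_right_mono) auto
      ultimately show ?thesis by simp
    qed
    have i: "integrable (?P n) (\<lambda>z. F n z * sqrt (?T n z) - \<sigma> * c)"
    proof (rule Bochner_Integration.integrable_bound[OF Bochner_Integration.integrable_add[OF iT iF]])
      show "(\<lambda>z. F n z * sqrt (?T n z) - \<sigma> * c) \<in> borel_measurable (?P n)" by measurable
    qed (use order_trans[OF pw abs_ge_self] in auto)
    have "integrable (?P n) (\<lambda>z. (F n z * sqrt (?T n z) - \<sigma> * c) + \<sigma> * c)"
      using i by (rule Bochner_Integration.integrable_add) simp
    then have i': "integrable (?P n) (\<lambda>z. F n z * sqrt (?T n z))" by simp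
    have "norm ((\<integral>z. F n z * sqrt (?T n z) \<partial>?P n) - \<sigma> * c) = \<bar>\<integral>z. F n z * sqrt (?T n z) - \<sigma> * c \<partial>?P n\<bar>"
      using i' by (subst Bochner_Integration.integral_diff) (auto simp: P.prob_space)
    also have "\<dots> \<le> (\<integral>z. \<bar>F n z * sqrt (?T n z) - \<sigma> * c\<bar> \<partial>?P n)"
      by (rule integral_abs_bound)
    also have "\<dots> \<le> (\<integral>z. \<bar>?T n z - \<sigma>\<^sup>2\<bar> / \<sigma> + \<sigma> * \<bar>F n z - c\<bar> \<partial>?P n)"
      using pw by (intro integral_mono integrable_abs i Bochner_Integration.integrable_add iT iF)
    also have "\<dots> = ?b n"
      using iT iF by (subst Bochner_Integration.integral_add) auto
    finally show ?case .
  qed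
qed

end

section \<open>Integrability of the dominating function and mass of the quartic density\<close>

lemma nn_integral_inverse_one_plus_square:
  assumes "0 < c"
  shows "(\<integral>\<^sup>+x. ennreal (1 / (1 + x\<^sup>2 / c)) \<partial>lborel) < \<infinity>"
proof -
  have i: "integrable lborel (\<lambda>x::real. inverse (1 + x\<^sup>2))"
    using integrable_inverse_1_plus_square by (simp add: set_integrable_def einterval_def)
  have "integrable lborel (\<lambda>x. inverse (1 + (0 + 1 / sqrt c * x)\<^sup>2))"
    using assms by (intro lborel_integrable_real_affine i) simp
  then have "integrable lborel (\<lambda>x. 1 / (1 + x\<^sup>2 / c))"
    using assms by (simp add: power_divide inverse_eq_divide)
  then show ?thesis
    using assms by (subst nn_integral_eq_integral) (auto intro: add_nonneg_nonneg)
qed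

text \<open>The substitution \<open>x = sqrt 2 * \<sigma> * t powr (1 / 4)\<close> turns
  \<open>x^4 / (4 * \<sigma>^4)\<close> into \<open>t\<close>, so the integral over the positive
  half-line is \<open>sqrt 2 * \<sigma> / 4 * Gamma (1 / 4)\<close>; evenness doubles it.\<close>

lemma nn_integral_quartic:
  assumes s: "0 < \<sigma>"
  shows "(\<integral>\<^sup>+x. ennreal (exp (- (x ^ 4) / (4 * \<sigma> ^ 4))) \<partial>lborel) = ennreal (\<sigma> / sqrt 2 * Gamma (1 / 4))"
proof -
  let ?f = "\<lambda>x::real. exp (- (x ^ 4) / (4 * \<sigma> ^ 4))"
  \<comment> \<open>\<open>h\<close> is the integrand of \<open>Gamma (1 / 4)\<close>, and
    \<open>g'\<close> is the derivative of the substitution \<open>g\<close>.\<close>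
  define h where "h t = t powr (- 3 / 4) / exp t" for t :: real
  define g where "g t = sqrt 2 * \<sigma> * t powr (1 / 4)" for t :: real
  define g' where "g' t = sqrt 2 * \<sigma> / 4 * t powr (- 3 / 4)" for t :: real
  have fg: "?f (g t) * g' t = sqrt 2 * \<sigma> / 4 * h t" if "0 < t" for t
  proof -
    have "(t powr (1 / 4)) ^ 4 = t"
      using that by (simp add: powr_power)
    moreover have "sqrt 2 ^ 4 = 4"
      by (simp add: power4_eq_xxxx)
    ultimately have "g t ^ 4 = 4 * \<sigma> ^ 4 * t"
      by (simp add: g_def power_mult_distrib)
    then show ?thesis using s by (simp add: g'_def h_def exp_minus field_simps)
  qed
  have h: "has_bochner_integral lborel (\<lambda>t. indicator {0<..} t *\<^sub>R h t) (Gamma (1 / 4))"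
  proof (rule has_bochner_integral_nn_integral)
    have "(\<integral>\<^sup>+t. ennreal (indicator {0<..} t *\<^sub>R h t) \<partial>lborel)
        = (\<integral>\<^sup>+t. ennreal (indicator {0..} t * t powr (1 / 4 - 1) / exp t) \<partial>lborel)"
      by (intro nn_integral_cong) (auto simp: h_def indicator_def)
    then show "(\<integral>\<^sup>+t. ennreal (indicator {0<..} t *\<^sub>R h t) \<partial>lborel) = ennreal (Gamma (1 / 4))"
      using Gamma_conv_nn_integral_real[of "1 / 4"] by simp
    show "(\<lambda>t. indicator {0<..} t *\<^sub>R h t) \<in> borel_measurable lborel"
      unfolding h_def by measurable
  qed (auto simp: h_def intro!: Gamma_real_nonneg)
  have e0: "einterval 0 \<infinity> = {0::real<..}" by (auto simp: einterval_def)
  have i: "set_integrable lborel (einterval 0 \<infinity>) (\<lambda>t. ?f (g t) * g' t)"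
  proof -
    have "set_integrable lborel {0<..} (\<lambda>t. sqrt 2 * \<sigma> / 4 * h t)"
      using h by (intro set_integrable_mult_right) (simp add: set_integrable_def has_bochner_integral_iff)
    moreover have "set_integrable lborel {0<..} (\<lambda>t. sqrt 2 * \<sigma> / 4 * h t)
        = set_integrable lborel {0<..} (\<lambda>t. ?f (g t) * g' t)"
      by (intro set_integrable_cong refl fg[symmetric]) simp
    ultimately show ?thesis by (simp only: e0)
  qed
  have dg: "DERIV g t :> g' t" if "0 < ereal t" for t
  proof -
    from that have "0 < t" by simp
    then show ?thesis unfolding g_def g'_def by (auto intro!: derivative_eq_intros)
  qed
  have A: "((ereal \<circ> g \<circ> real_of_ereal) \<longlongrightarrow> 0) (at_right 0)"
    unfolding zero_ereal_def ereal_tendsto_simps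
    unfolding g_def using s by real_asymp
  have B: "((ereal \<circ> g \<circ> real_of_ereal) \<longlongrightarrow> \<infinity>) (at_left \<infinity>)"
    unfolding ereal_tendsto_simps
    unfolding g_def using s by real_asymp
  have g'c: "isCont g' t" if "0 < ereal t" for t
    using that unfolding g'_def by (auto intro!: continuous_intros)
  have fc: "isCont ?f (g t)" for t by (intro continuous_intros) (use s in auto)
  note sub = interval_integral_substitution_nonneg[where f = ?f, OF _ dg fc g'c _ _ A B i]
  have "set_integrable lborel {0<..} ?f"
    using sub(1) s by (simp add: e0 g'_def)
  moreover have "(LBINT x:{0<..}. ?f x) = sqrt 2 * \<sigma> / 4 * Gamma (1 / 4)"
  proof -
    have "(LBINT x:{0<..}. ?f x) = (LBINT x=0..\<infinity>. ?f x)"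
      unfolding zero_ereal_def by (rule interval_integral_to_infinity_eq[symmetric])
    also have "\<dots> = (LBINT t=0..\<infinity>. ?f (g t) * g' t)"
      using sub(2) s by (simp add: g'_def)
    also have "\<dots> = (LBINT t:{0<..}. ?f (g t) * g' t)"
      unfolding zero_ereal_def by (rule interval_integral_to_infinity_eq)
    also have "\<dots> = (LBINT t:{0<..}. sqrt 2 * \<sigma> / 4 * h t)"
      by (rule set_lebesgue_integral_cong) (simp, metis fg greaterThan_iff)
    also have "\<dots> = sqrt 2 * \<sigma> / 4 * Gamma (1 / 4)"
      using h by (simp add: set_lebesgue_integral_def has_bochner_integral_iff)
    finally show ?thesis .
  qed
  ultimately have "has_bochner_integral lborel (\<lambda>x. indicator {0<..} x *\<^sub>R ?f x) (sqrt 2 * \<sigma> / 4 * Gamma (1 / 4))"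
    by (simp add: has_bochner_integral_iff set_integrable_def set_lebesgue_integral_def)
  \<comment> \<open>The rule for even functions takes the closed half-line; the added point is a
    null set.\<close>
  then have "has_bochner_integral lborel (\<lambda>x. indicator {0..} x *\<^sub>R ?f x) (sqrt 2 * \<sigma> / 4 * Gamma (1 / 4))"
    by (rule has_bochner_integral_discrete_difference[of "{0}", THEN iffD1, rotated -1])
       (auto simp: indicator_def)
  then have "has_bochner_integral lborel ?f (2 *\<^sub>R (sqrt 2 * \<sigma> / 4 * Gamma (1 / 4)))"
    by (rule has_bochner_integral_even_function) simp
  moreover have "2 *\<^sub>R (sqrt 2 * \<sigma> / 4 * Gamma (1 / 4)) = \<sigma> / sqrt 2 * Gamma (1 / 4)"
    by (simp add: field_simps)
  ultimately have hb: "has_bochner_integral lborel ?f (\<sigma> / sqrt 2 * Gamma (1 / 4))"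
    by (simp only:)
  then have "(\<integral>\<^sup>+x. ennreal (?f x) \<partial>lborel) = ennreal (\<integral>x. ?f x \<partial>lborel)"
    by (intro nn_integral_eq_integral) (auto simp: has_bochner_integral_iff)
  also have "(\<integral>x. ?f x \<partial>lborel) = \<sigma> / sqrt 2 * Gamma (1 / 4)"
    using hb by (rule has_bochner_integral_integral_eq)
  finally show ?thesis .
qed

section \<open>Passage to the limit under the mixing integral\<close>

context
  fixes \<sigma> :: real
  assumes s: "0 < \<sigma>"
begin

text \<open>The integrand of the mixture in the variable \<open>x\<close>, with
  \<open>sqrt T\<close> normalised to \<open>sqrt (T / n)\<close>, which tends to
  \<open>\<sigma>\<close>. Values in \<open>ennreal\<close> allow the mixture identity to be stated
  before finiteness is known.\<close>

definition "tilted_weight n F x = ennreal (tilt_mass \<sigma> (tilt_scale \<sigma> x n) ^ n) *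
     (\<integral>\<^sup>+z. ennreal (F z) * ennreal (sqrt ((\<Sum>i=1..n. (z i)\<^sup>2) / n)) \<partial>tilted n \<sigma> (tilt_scale \<sigma> x n))"

text \<open>A bound uniform in \<open>n\<close> and \<open>y\<close>, as dominated convergence
  requires: \<open>F \<le> 1\<close> and \<open>sqrt t \<le> 1 + t\<close> reduce it to the mean of
  \<open>T / n\<close>.\<close>

lemma integrable_weighted_tilted:
  assumes n: "1 \<le> n" and F: "F \<in> borel_measurable (PiM {1..n} (\<lambda>_. borel))" "\<And>z. 0 \<le> F z" "\<And>z. F z \<le> 1"
  shows "integrable (tilted n \<sigma> y) (\<lambda>z. F z * sqrt ((\<Sum>i=1..n. (z i)\<^sup>2) / n))"
    and "(\<integral>z. F z * sqrt ((\<Sum>i=1..n. (z i)\<^sup>2) / n) \<partial>tilted n \<sigma> y) \<le> 1 + 8 * \<sigma>\<^sup>2"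
proof -
  let ?P = "tilted n \<sigma> y"
  let ?T = "\<lambda>z. (\<Sum>i=1..n. (z i)\<^sup>2) / real n :: real"
  interpret P: prob_space ?P by (intro prob_space_PiM prob_space_tilted_gauss s)
  have setsP: "sets ?P = sets (PiM {1..n} (\<lambda>_. borel :: real measure))"
    by (intro sets_PiM_real) simp
  have [measurable]: "F \<in> borel_measurable ?P"
    using F(1) setsP by (simp cong: measurable_cong_sets)
  have T0: "0 \<le> ?T z" for z by (intro divide_nonneg_nonneg sum_nonneg) auto
  have iT: "integrable ?P ?T"
    using L1_square_mean_tilted(1)[OF s n, of y 0] by simp
  have pw: "F z * sqrt (?T z) \<le> 1 + ?T z" for z
  proof -
    have "F z * sqrt (?T z) \<le> 1 * sqrt (?T z)" using F T0 by (intro mult_right_mono) auto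
    moreover have "sqrt t \<le> 1 + t" if "0 \<le> t" for t :: real
      using that by (intro real_le_lsqrt) (auto simp: power2_eq_square algebra_simps)
    ultimately show ?thesis using T0[of z] by (metis mult_1 order_trans)
  qed
  have iT1: "integrable ?P (\<lambda>z. 1 + ?T z)"
    using iT by (intro Bochner_Integration.integrable_add) (auto)
  show i: "integrable ?P (\<lambda>z. F z * sqrt (?T z))"
  proof (rule Bochner_Integration.integrable_bound[OF iT1])
    show "(\<lambda>z. F z * sqrt (?T z)) \<in> borel_measurable ?P" by measurable
  qed (use F(2) T0 pw in \<open>auto simp: abs_mult abs_of_nonneg add_nonneg_nonneg\<close>)
  \<comment> \<open>With \<open>1 / sqrt n \<le> 1\<close> and \<open>sqrt 2 \<le> 2\<close> the
    bound becomes \<open>2 * |m| * s + 2 * s^2 + m^2 + s^2\<close>. As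
    \<open>2 * |m| * s \<le> m^2 + s^2\<close>, this is at most \<open>4 * (m^2 + s^2)\<close>,
    whence \<open>8 * \<sigma>^2\<close>.\<close>
  have m: "(\<integral>z. ?T z \<partial>?P) \<le> 8 * \<sigma>\<^sup>2"
  proof -
    let ?m = "tilt_mean \<sigma> y" and ?s = "tilt_sd \<sigma> y"
    have s0: "0 \<le> ?s" using tilt_sd_pos[OF s, of y] by simp
    have d: "a / sqrt n \<le> a" if "0 \<le> a" for a
      using that n by (simp add: divide_le_eq mult_le_cancel_left1)
    have "(\<integral>z. ?T z \<partial>?P) \<le> 2 * \<bar>?m\<bar> * (?s / sqrt n) + sqrt 2 * ?s\<^sup>2 / sqrt n + \<bar>?m\<^sup>2 + ?s\<^sup>2\<bar>"
      using L1_square_mean_tilted(2)[OF s n, of y 0] by (simp add: abs_of_nonneg[OF sum_nonneg])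
    also have "\<dots> \<le> 2 * \<bar>?m\<bar> * ?s + 2 * ?s\<^sup>2 + (?m\<^sup>2 + ?s\<^sup>2)"
      using d[of ?s] d[of "sqrt 2 * ?s\<^sup>2"] s0 sqrt2_less_2
      by (intro add_mono mult_left_mono order_trans[OF d mult_right_mono]) auto
    also have "2 * \<bar>?m\<bar> * ?s \<le> ?m\<^sup>2 + ?s\<^sup>2"
      using sum_squares_bound[of "\<bar>?m\<bar>" ?s] by simp
    finally show ?thesis using tilt_second_moment_le[OF s, of y] zero_le_power2[of ?m] by linarith
  qed
  have "(\<integral>z. F z * sqrt (?T z) \<partial>?P) \<le> (\<integral>z. 1 + ?T z \<partial>?P)"
    by (intro integral_mono i iT1 pw)
  also have "\<dots> \<le> 1 + 8 * \<sigma>\<^sup>2"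
    using iT m by (subst Bochner_Integration.integral_add) (auto simp: P.prob_space)
  finally show "(\<integral>z. F z * sqrt (?T z) \<partial>?P) \<le> 1 + 8 * \<sigma>\<^sup>2" .
qed

lemma tilted_weight_eq:
  assumes n: "1 \<le> n" and F: "F \<in> borel_measurable (PiM {1..n} (\<lambda>_. borel))" "\<And>z. 0 \<le> F z" "\<And>z. F z \<le> 1"
  shows "tilted_weight n F x = ennreal (tilt_mass \<sigma> (tilt_scale \<sigma> x n) ^ n *
     (\<integral>z. F z * sqrt ((\<Sum>i=1..n. (z i)\<^sup>2) / n) \<partial>tilted n \<sigma> (tilt_scale \<sigma> x n)))"
proof -
  have nn: "0 \<le> (\<Sum>i=1..n. (z i)\<^sup>2) / real n" for z :: "nat \<Rightarrow> real"
    by (intro divide_nonneg_nonneg sum_nonneg) auto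
  have "(\<integral>\<^sup>+z. ennreal (F z) * ennreal (sqrt ((\<Sum>i=1..n. (z i)\<^sup>2) / n)) \<partial>tilted n \<sigma> (tilt_scale \<sigma> x n))
    = ennreal (\<integral>z. F z * sqrt ((\<Sum>i=1..n. (z i)\<^sup>2) / n) \<partial>tilted n \<sigma> (tilt_scale \<sigma> x n))"
    using F nn by (subst nn_integral_eq_integral[symmetric])
      (auto simp: ennreal_mult intro!: integrable_weighted_tilted[OF n])
  then show ?thesis
    using F nn by (simp add: tilted_weight_def ennreal_mult' less_imp_le[OF tilt_mass_pos])
qed

text \<open>The mixture identity after the substitution \<open>y = tilt_scale \<sigma> x n\<close>; the factors of the
  left-hand side cancel in quotients.\<close>

lemma nn_integral_tilted_weight:
  assumes n: "1 \<le> n" and F: "F \<in> borel_measurable (PiM {1..n} (\<lambda>_. borel))"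
  shows "ennreal (sqrt (2 * pi) * (\<sigma>\<^sup>2 * real n powr (1 / 4)) / sqrt n) *
       (\<integral>\<^sup>+x. ennreal (F x) * ennreal (exp (interaction n x)) \<partial>PiM {1..n} (\<lambda>_. gauss \<sigma>))
     = (\<integral>\<^sup>+x. tilted_weight n F x \<partial>lborel)"
    and "tilted_weight n F \<in> borel_measurable borel"
proof -
  let ?T = "\<lambda>z. (\<Sum>i=1..n. (z i)\<^sup>2) :: real"
  have FF: "(\<lambda>z. ennreal (F z)) \<in> borel_measurable (PiM {1..n} (\<lambda>_. borel))"
    using F by measurable
  note mix = nn_integral_interaction_mixture[OF s n FF]
  define f where "f y = ennreal (tilt_mass \<sigma> y ^ n) *
           (\<integral>\<^sup>+z. ennreal (F z) * ennreal (sqrt (?T z)) \<partial>tilted n \<sigma> y)" for y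
  define c where "c = \<sigma>\<^sup>2 * real n powr (1 / 4)"
  have c: "0 < c" using s n by (simp add: c_def)
  have [measurable]: "f \<in> borel_measurable borel" using mix(2) unfolding f_def .
  have sc: "tilt_scale \<sigma> x n = 0 + 1 / c * x" for x by (simp add: tilt_scale_def c_def)
  have w: "tilted_weight n F x = ennreal (1 / sqrt n) * f (0 + 1 / c * x)" for x
  proof -
    have [measurable]: "(\<lambda>z. ennreal (F z)) \<in> borel_measurable (tilted n \<sigma> (tilt_scale \<sigma> x n))"
      using FF sets_PiM_real[of "\<lambda>_. tilted_gauss \<sigma> (tilt_scale \<sigma> x n)" "{1..n}"]
      by (simp cong: measurable_cong_sets)
    have "(\<integral>\<^sup>+z. ennreal (F z) * ennreal (sqrt (?T z / n)) \<partial>tilted n \<sigma> (tilt_scale \<sigma> x n))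
      = (\<integral>\<^sup>+z. ennreal (1 / sqrt n) * (ennreal (F z) * ennreal (sqrt (?T z))) \<partial>tilted n \<sigma> (tilt_scale \<sigma> x n))"
    proof (rule nn_integral_cong)
      fix z :: "nat \<Rightarrow> real"
      have "ennreal (sqrt (?T z / n)) = ennreal (1 / sqrt n) * ennreal (sqrt (?T z))"
        by (subst ennreal_mult[symmetric]) (auto simp: real_sqrt_divide intro!: sum_nonneg)
      then show "ennreal (F z) * ennreal (sqrt (?T z / n)) = ennreal (1 / sqrt n) * (ennreal (F z) * ennreal (sqrt (?T z)))"
        by (simp add: mult_ac)
    qed
    also have "\<dots> = ennreal (1 / sqrt n) * (\<integral>\<^sup>+z. ennreal (F z) * ennreal (sqrt (?T z)) \<partial>tilted n \<sigma> (tilt_scale \<sigma> x n))"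
      by (intro nn_integral_cmult) measurable
    finally show ?thesis
      unfolding tilted_weight_def f_def sc by (simp add: mult_ac)
  qed
  show "tilted_weight n F \<in> borel_measurable borel"
    unfolding w[abs_def] by measurable
  have "(\<integral>\<^sup>+x. tilted_weight n F x \<partial>lborel) = ennreal (1 / sqrt n) * (\<integral>\<^sup>+x. f (0 + 1 / c * x) \<partial>lborel)"
    unfolding w by (intro nn_integral_cmult) measurable
  \<comment> \<open>The product \<open>c * (1 / c) = 1\<close> is inserted to supply the factor
    \<open>1 / c\<close> of the affine change of variables.\<close>
  also have "(\<integral>\<^sup>+x. f (0 + 1 / c * x) \<partial>lborel) = ennreal c * (ennreal \<bar>1 / c\<bar> * (\<integral>\<^sup>+x. f (0 + 1 / c * x) \<partial>lborel))"
    using c by (simp add: mult.assoc[symmetric] ennreal_mult[symmetric])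
  also have "ennreal \<bar>1 / c\<bar> * (\<integral>\<^sup>+x. f (0 + 1 / c * x) \<partial>lborel) = (\<integral>\<^sup>+x. f x \<partial>lborel)"
    using c by (intro nn_integral_real_affine[symmetric]) auto
  also have "\<dots> = ennreal (sqrt (2 * pi)) * (\<integral>\<^sup>+x. ennreal (F x) * ennreal (exp (interaction n x)) \<partial>PiM {1..n} (\<lambda>_. gauss \<sigma>))"
    unfolding f_def by (rule mix(1)[symmetric])
  also have "ennreal (1 / sqrt n) * (ennreal c * (ennreal (sqrt (2 * pi)) * A)) 
      = ennreal (sqrt (2 * pi) * c / sqrt n) * A" for A
  proof -
    have "ennreal (sqrt (2 * pi) * c / sqrt n) = ennreal (1 / sqrt n) * ennreal c * ennreal (sqrt (2 * pi))"
      using c by (simp add: ennreal_mult[symmetric] mult_ac)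
    then show ?thesis by (simp add: mult_ac)
  qed
  finally show "ennreal (sqrt (2 * pi) * (\<sigma>\<^sup>2 * real n powr (1 / 4)) / sqrt n) *
       (\<integral>\<^sup>+x. ennreal (F x) * ennreal (exp (interaction n x)) \<partial>PiM {1..n} (\<lambda>_. gauss \<sigma>))
     = (\<integral>\<^sup>+x. tilted_weight n F x \<partial>lborel)" by (simp add: c_def)
qed

text \<open>Dominated convergence. For fixed \<open>x\<close> the power of \<open>tilt_mass\<close>
  tends to the quartic exponential and the inner integral to \<open>\<sigma> * c x\<close>; the
  dominating function combines \<open>tilt_mass_power_le\<close> with the uniform bound
  \<open>1 + 8 * \<sigma>^2\<close>.\<close>

lemma nn_integral_tilted_weight_tendsto:
  fixes F :: "nat \<Rightarrow> (nat \<Rightarrow> real) \<Rightarrow> real"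
  assumes F: "\<And>n. F n \<in> borel_measurable (PiM {1..n} (\<lambda>_. borel))" "\<And>n z. 0 \<le> F n z" "\<And>n z. F n z \<le> 1"
    and c [measurable]: "c \<in> borel_measurable borel" 
    and lim: "\<And>x. (\<lambda>n. \<integral>z. \<bar>F n z - c x\<bar> \<partial>tilted n \<sigma> (tilt_scale \<sigma> x n)) \<longlonglongrightarrow> 0"
  shows "(\<lambda>n. \<integral>\<^sup>+x. tilted_weight n (F n) x \<partial>lborel)
     \<longlonglongrightarrow> (\<integral>\<^sup>+x. ennreal (exp (- (x ^ 4) / (4 * \<sigma> ^ 4)) * (\<sigma> * c x)) \<partial>lborel)"
\<comment> \<open>The bound of \<open>tilt_mass_power_le\<close> holds from \<open>n = 4\<close> on,
  hence the shift.\<close>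
proof (rule LIMSEQ_offset[where k = 4], rule nn_integral_dominated_convergence)
  let ?w = "\<lambda>x. ennreal (exp 2 * (1 + 8 * \<sigma>\<^sup>2) * (1 / (1 + x\<^sup>2 / (2 * \<sigma>\<^sup>2))))"
  show "(\<lambda>x. tilted_weight (n + 4) (F (n + 4)) x) \<in> borel_measurable lborel" for n
    using nn_integral_tilted_weight(2)[of "n + 4" "F (n + 4)"] F(1)[of "n + 4"] by simp
  show "(\<lambda>x. ennreal (exp (- (x ^ 4) / (4 * \<sigma> ^ 4)) * (\<sigma> * c x))) \<in> borel_measurable lborel"
    by measurable
  show "?w \<in> borel_measurable lborel" by measurable
  show "AE x in lborel. tilted_weight (n + 4) (F (n + 4)) x \<le> ?w x" for n
  proof (rule AE_I2)
    fix x :: real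
    have "tilt_mass \<sigma> (tilt_scale \<sigma> x (n + 4)) ^ (n + 4) *
      (\<integral>z. F (n + 4) z * sqrt ((\<Sum>i=1..n + 4. (z i)\<^sup>2) / real (n + 4)) \<partial>tilted (n + 4) \<sigma> (tilt_scale \<sigma> x (n + 4)))
      \<le> exp 2 / (1 + x\<^sup>2 / (2 * \<sigma>\<^sup>2)) * (1 + 8 * \<sigma>\<^sup>2)"
      using F s by (intro mult_mono tilt_mass_power_le integrable_weighted_tilted(2) Bochner_Integration.integral_nonneg)
        (auto intro!: mult_nonneg_nonneg sum_nonneg divide_nonneg_nonneg add_nonneg_nonneg)
    then show "tilted_weight (n + 4) (F (n + 4)) x \<le> ?w x"
      using F by (subst tilted_weight_eq) (auto intro!: ennreal_leI simp: mult_ac)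
  qed
  show "(\<integral>\<^sup>+x. ?w x \<partial>lborel) < \<infinity>"
  proof -
    have "(\<integral>\<^sup>+x. ?w x \<partial>lborel) = ennreal (exp 2 * (1 + 8 * \<sigma>\<^sup>2)) * (\<integral>\<^sup>+x. ennreal (1 / (1 + x\<^sup>2 / (2 * \<sigma>\<^sup>2))) \<partial>lborel)"
      by (subst nn_integral_cmult[symmetric]) (auto simp: ennreal_mult[symmetric] add_nonneg_nonneg)
    then show ?thesis
      using nn_integral_inverse_one_plus_square[of "2 * \<sigma>\<^sup>2"] s by (simp add: ennreal_mult_less_top)
  qed
  show "AE x in lborel. (\<lambda>n. tilted_weight (n + 4) (F (n + 4)) x)
     \<longlonglongrightarrow> ennreal (exp (- (x ^ 4) / (4 * \<sigma> ^ 4)) * (\<sigma> * c x))"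
  proof (rule AE_I2)
    fix x :: real
    have "(\<lambda>n. ennreal (tilt_mass \<sigma> (tilt_scale \<sigma> x n) ^ n *
        (\<integral>z. F n z * sqrt ((\<Sum>i=1..n. (z i)\<^sup>2) / n) \<partial>tilted n \<sigma> (tilt_scale \<sigma> x n))))
      \<longlonglongrightarrow> ennreal (exp (- (x ^ 4) / (4 * \<sigma> ^ 4)) * (\<sigma> * c x))"
      by (intro tendsto_ennrealI tendsto_mult tilt_mass_power_tendsto weighted_tilted_tendsto s F lim)
    from LIMSEQ_ignore_initial_segment[OF this, of 4]
    show "(\<lambda>n. tilted_weight (n + 4) (F (n + 4)) x)
     \<longlonglongrightarrow> ennreal (exp (- (x ^ 4) / (4 * \<sigma> ^ 4)) * (\<sigma> * c x))"
      using F by (subst tilted_weight_eq) (auto)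
  qed
qed

end

subsection \<open>Limit of the tilted measures\<close>

lemma quartic_constant_pos: "0 < \<sigma> \<Longrightarrow> 0 < \<sigma> / sqrt 2 * Gamma (1 / 4)"
  by (simp add: Gamma_real_pos)

lemma nn_integral_quartic_measure:
  assumes s: "0 < \<sigma>" and c [measurable]: "c \<in> borel_measurable borel" "\<And>x. 0 \<le> c x"
  shows "(\<integral>\<^sup>+x. ennreal (exp (- (x ^ 4) / (4 * \<sigma> ^ 4)) * c x) \<partial>lborel)
     = ennreal (\<sigma> / sqrt 2 * Gamma (1 / 4)) * (\<integral>\<^sup>+x. ennreal (c x) \<partial>quartic_measure \<sigma>)"
proof -
  define C where "C = \<sigma> / sqrt 2 * Gamma (1 / 4)"
  have C: "0 < C" unfolding C_def by (rule quartic_constant_pos[OF s])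
  have "(\<integral>\<^sup>+x. ennreal (c x) \<partial>quartic_measure \<sigma>)
      = (\<integral>\<^sup>+x. ennreal (inverse C * exp (- (x ^ 4) / (4 * \<sigma> ^ 4))) * ennreal (c x) \<partial>lborel)"
    unfolding quartic_measure_def C_def by (intro nn_integral_density) auto
  then have "ennreal C * (\<integral>\<^sup>+x. ennreal (c x) \<partial>quartic_measure \<sigma>)
      = (\<integral>\<^sup>+x. ennreal C * (ennreal (inverse C * exp (- (x ^ 4) / (4 * \<sigma> ^ 4))) * ennreal (c x)) \<partial>lborel)"
    by (simp add: nn_integral_cmult)
  also have "\<dots> = (\<integral>\<^sup>+x. ennreal (exp (- (x ^ 4) / (4 * \<sigma> ^ 4)) * c x) \<partial>lborel)"
    using C c(2) by (intro nn_integral_cong) (simp add: ennreal_mult[symmetric] field_simps)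
  finally show ?thesis by (simp add: C_def)
qed

lemma prob_space_quartic_measure:
  assumes s: "0 < \<sigma>"
  shows "prob_space (quartic_measure \<sigma>)"
proof
  have C: "0 < \<sigma> / sqrt 2 * Gamma (1 / 4)" by (rule quartic_constant_pos[OF s])
  have "ennreal (\<sigma> / sqrt 2 * Gamma (1 / 4)) * emeasure (quartic_measure \<sigma>) (space (quartic_measure \<sigma>))
      = ennreal (\<sigma> / sqrt 2 * Gamma (1 / 4)) * 1"
    using nn_integral_quartic_measure[OF s, of "\<lambda>_. 1"] nn_integral_quartic[OF s] by simp
  then show "emeasure (quartic_measure \<sigma>) (space (quartic_measure \<sigma>)) = 1"
    using C by (subst (asm) ennreal_mult_cancel_left) auto
qed

lemma sets_mu_tilde [simp]: "sets (mu_tilde n \<sigma>) = sets (PiM {1..n} (\<lambda>_. borel))"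
  unfolding mu_tilde_def by (subst sets_density) (intro sets_PiM_real, simp)

text \<open>The case \<open>F = 1\<close> determines the normalisation, so that \<open>Z n\<close> is never computed.\<close>

lemma integral_mu_tilde:
  assumes s: "0 < \<sigma>" and n: "1 \<le> n" and P: "prob_space (mu_tilde n \<sigma>)"
    and F: "F \<in> borel_measurable (PiM {1..n} (\<lambda>_. borel))" "\<And>z. 0 \<le> F z"
  shows "(\<integral>z. F z \<partial>mu_tilde n \<sigma>) =
    enn2real (\<integral>\<^sup>+x. tilted_weight \<sigma> n F x \<partial>lborel) / enn2real (\<integral>\<^sup>+x. tilted_weight \<sigma> n (\<lambda>_. 1) x \<partial>lborel)"
proof -
  interpret prob_space "mu_tilde n \<sigma>" by fact
  let ?P = "PiM {1..n} (\<lambda>_. gauss \<sigma>)"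
  let ?N = "\<lambda>F. \<integral>\<^sup>+x. ennreal (F x) * ennreal (exp (interaction n x)) \<partial>?P"
  have setsP [measurable_cong]: "sets ?P = sets (PiM {1..n} (\<lambda>_. borel :: real measure))"
    by (intro sets_PiM_real) simp
  have [measurable]: "interaction n \<in> borel_measurable ?P"
    unfolding interaction_def by measurable
  have mu: "(\<integral>\<^sup>+z. ennreal (F z) \<partial>mu_tilde n \<sigma>) = ennreal (1 / Z n) * ?N F"
    if [measurable]: "F \<in> borel_measurable (PiM {1..n} (\<lambda>_. borel))" for F
  proof -
    have "ennreal (1 / Z n * exp t) = ennreal (1 / Z n) * ennreal (exp t)" for t
      by (rule ennreal_mult'') simp
    then show ?thesis
      unfolding mu_tilde_def
      by (subst nn_integral_density) (auto simp: nn_integral_cmult[symmetric] mult_ac intro!: nn_integral_cong)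
  qed
  define k where "k = sqrt (2 * pi) * (\<sigma>\<^sup>2 * real n powr (1 / 4)) / sqrt n"
  have k: "0 < k" using s n by (simp add: k_def)
  have W: "enn2real (\<integral>\<^sup>+x. tilted_weight \<sigma> n F x \<partial>lborel) = k * enn2real (?N F)"
    if "F \<in> borel_measurable (PiM {1..n} (\<lambda>_. borel))" for F
    unfolding nn_integral_tilted_weight(1)[OF s n that, symmetric] k_def[symmetric] using k by (simp add: enn2real_mult)
  define a where "a = enn2real (ennreal (1 / Z n))"
  \<comment> \<open>Total mass 1 forces \<open>enn2real\<close> of the integral for
    \<open>F = 1\<close> to be nonzero. This also excludes the value infinity, which
    \<open>enn2real\<close> sends to 0, so the quotient formed below is meaningful.\<close>
  have one: "1 = a * enn2real (?N (\<lambda>_. 1))"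
    using mu[of "\<lambda>_. 1"] emeasure_space_1 by (simp add: a_def enn2real_mult[symmetric])
  have "(\<integral>z. F z \<partial>mu_tilde n \<sigma>) = enn2real (\<integral>\<^sup>+z. ennreal (F z) \<partial>mu_tilde n \<sigma>)"
    using F by (intro integral_eq_nn_integral) (auto cong: measurable_cong_sets)
  also have "\<dots> = a * enn2real (?N F)"
    using mu[OF F(1)] by (simp add: a_def enn2real_mult)
  also have "\<dots> = (k * enn2real (?N F)) / (k * enn2real (?N (\<lambda>_. 1)))"
    using one k by (cases "enn2real (?N (\<lambda>_. 1)) = 0") (auto simp: field_simps)
  finally show ?thesis by (simp add: W F)
qed

text \<open>By \<open>integral_mu_tilde\<close> the expectation is a quotient of mixing integrals.
  The numerator tends to \<open>C * \<sigma>\<close> times the integral of \<open>c\<close>, and the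
  denominator, the case \<open>F = 1\<close>, to \<open>C * \<sigma>\<close>. A limit theorem thus
  reduces to the convergence of \<open>F\<close> to the constant \<open>c x\<close> in mean under
  the tilted laws.\<close>

lemma integral_mu_tilde_tendsto:
  fixes F :: "nat \<Rightarrow> (nat \<Rightarrow> real) \<Rightarrow> real"
  assumes s: "0 < \<sigma>" and P: "\<And>n. 1 \<le> n \<Longrightarrow> prob_space (mu_tilde n \<sigma>)"
    and F: "\<And>n. F n \<in> borel_measurable (PiM {1..n} (\<lambda>_. borel))" "\<And>n z. 0 \<le> F n z" "\<And>n z. F n z \<le> 1"
    and c [measurable]: "c \<in> borel_measurable borel" and c01: "\<And>x. 0 \<le> c x" "\<And>x. c x \<le> 1"
    and lim: "\<And>x. (\<lambda>n. \<integral>z. \<bar>F n z - c x\<bar> \<partial>tilted n \<sigma> (tilt_scale \<sigma> x n)) \<longlonglongrightarrow> 0"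
  shows "(\<lambda>n. \<integral>z. F n z \<partial>mu_tilde n \<sigma>) \<longlonglongrightarrow> (\<integral>x. c x \<partial>quartic_measure \<sigma>)"
proof -
  define C where "C = \<sigma> / sqrt 2 * Gamma (1 / 4)"
  have C: "0 < C" unfolding C_def by (rule quartic_constant_pos[OF s])
  interpret Q: prob_space "quartic_measure \<sigma>" by (rule prob_space_quartic_measure[OF s])
  have setsQ [measurable_cong]: "sets (quartic_measure \<sigma>) = sets borel"
    by (simp add: quartic_measure_def)
  \<comment> \<open>Stated for arbitrary \<open>F\<close> and \<open>c\<close> because it is applied
    twice: to the given ones and to the constant 1.\<close>
  have W: "(\<lambda>n. enn2real (\<integral>\<^sup>+x. tilted_weight \<sigma> n (F n) x \<partial>lborel)) \<longlonglongrightarrow> C * (\<sigma> * (\<integral>x. c x \<partial>quartic_measure \<sigma>))"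
    if F: "\<And>n. F n \<in> borel_measurable (PiM {1..n} (\<lambda>_. borel))" "\<And>n z. 0 \<le> F n z" "\<And>n z. F n z \<le> 1"
    and c [measurable]: "c \<in> borel_measurable borel" and c01: "\<And>x. 0 \<le> c x" "\<And>x. c x \<le> 1"
    and lim: "\<And>x. (\<lambda>n. \<integral>z. \<bar>F n z - c x\<bar> \<partial>tilted n \<sigma> (tilt_scale \<sigma> x n)) \<longlonglongrightarrow> 0"
    for F :: "nat \<Rightarrow> (nat \<Rightarrow> real) \<Rightarrow> real" and c
  proof (rule tendsto_enn2real)
    have "integrable (quartic_measure \<sigma>) c"
      using c01 by (intro Q.integrable_const_bound[where B = 1]) auto
    then have "(\<integral>\<^sup>+x. ennreal (\<sigma> * c x) \<partial>quartic_measure \<sigma>) = ennreal (\<sigma> * (\<integral>x. c x \<partial>quartic_measure \<sigma>))"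
      using s c01 by (subst nn_integral_eq_integral) auto
    moreover have "(\<integral>\<^sup>+x. ennreal (exp (- (x ^ 4) / (4 * \<sigma> ^ 4)) * (\<sigma> * c x)) \<partial>lborel)
        = ennreal C * (\<integral>\<^sup>+x. ennreal (\<sigma> * c x) \<partial>quartic_measure \<sigma>)"
      unfolding C_def using s c01 by (intro nn_integral_quartic_measure) auto
    ultimately have "(\<integral>\<^sup>+x. ennreal (exp (- (x ^ 4) / (4 * \<sigma> ^ 4)) * (\<sigma> * c x)) \<partial>lborel)
        = ennreal (C * (\<sigma> * (\<integral>x. c x \<partial>quartic_measure \<sigma>)))"
      using C by (simp only: ennreal_mult' less_imp_le)
    then show "(\<lambda>n. \<integral>\<^sup>+x. tilted_weight \<sigma> n (F n) x \<partial>lborel) \<longlonglongrightarrow> ennreal (C * (\<sigma> * (\<integral>x. c x \<partial>quartic_measure \<sigma>)))"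
      using nn_integral_tilted_weight_tendsto[OF s F c lim] by simp
    show "0 \<le> C * (\<sigma> * (\<integral>x. c x \<partial>quartic_measure \<sigma>))"
      using C s c01 by (intro mult_nonneg_nonneg Bochner_Integration.integral_nonneg) auto
  qed
  have "(\<lambda>n. enn2real (\<integral>\<^sup>+x. tilted_weight \<sigma> n (\<lambda>_. 1) x \<partial>lborel)) \<longlonglongrightarrow> C * (\<sigma> * (\<integral>x. 1 \<partial>quartic_measure \<sigma>))"
    by (rule W) auto
  then have W1: "(\<lambda>n. enn2real (\<integral>\<^sup>+x. tilted_weight \<sigma> n (\<lambda>_. 1) x \<partial>lborel)) \<longlonglongrightarrow> C * \<sigma>"
    by (simp add: Q.prob_space)
  have "(\<lambda>n. enn2real (\<integral>\<^sup>+x. tilted_weight \<sigma> n (F n) x \<partial>lborel) / enn2real (\<integral>\<^sup>+x. tilted_weight \<sigma> n (\<lambda>_. 1) x \<partial>lborel))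
      \<longlonglongrightarrow> (C * (\<sigma> * (\<integral>x. c x \<partial>quartic_measure \<sigma>))) / (C * \<sigma>)"
    using C s by (intro tendsto_divide W W1 F c c01 lim) auto
  then have "(\<lambda>n. enn2real (\<integral>\<^sup>+x. tilted_weight \<sigma> n (F n) x \<partial>lborel) / enn2real (\<integral>\<^sup>+x. tilted_weight \<sigma> n (\<lambda>_. 1) x \<partial>lborel))
      \<longlonglongrightarrow> (\<integral>x. c x \<partial>quartic_measure \<sigma>)"
    using C s by simp
  then show ?thesis
    by (rule Lim_transform_eventually)
       (use eventually_ge_at_top[of 1] in \<open>eventually_elim, simp add: integral_mu_tilde[OF s _ P] F\<close>)
qed

section \<open>Test functions for the two limits\<close>

lemma integrable_sum_tilted:
  assumes s: "0 < \<sigma>" and n: "1 \<le> n"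
  shows "integrable (tilted n \<sigma> y) (\<lambda>z. \<Sum>i=1..n. z i)"
proof -
  interpret P: prob_space "tilted n \<sigma> y" by (intro prob_space_PiM prob_space_tilted_gauss s)
  let ?m = "tilt_mean \<sigma> y"
  have "integrable (tilted n \<sigma> y) (\<lambda>z. n * ((\<Sum>i=1..n. z i) / n - ?m) + n * ?m)"
    using L1_normal_mean(1)[where m = "?m", OF tilt_sd_pos[OF s] n, of y, folded tilted_gauss_def]
    by (intro Bochner_Integration.integrable_add integrable_mult_right) auto
  then show ?thesis using n by (simp add: algebra_simps)
qed

text \<open>\<open>S / n\<close> is \<open>n powr (- 1 / 4)\<close> times
  \<open>S / n powr (3 / 4)\<close>, and the latter converges to \<open>x\<close> in mean, so its
  mean absolute value stays bounded.\<close>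

lemma mean_tilted_tendsto:
  assumes s: "0 < \<sigma>"
  shows "(\<lambda>n. \<integral>z. \<bar>(\<Sum>i=1..n. z i) / n\<bar> \<partial>tilted n \<sigma> (tilt_scale \<sigma> x n)) \<longlonglongrightarrow> 0"
proof (rule Lim_null_comparison)
  let ?P = "\<lambda>n. tilted n \<sigma> (tilt_scale \<sigma> x n)"
  let ?Y = "\<lambda>n z. (\<Sum>i=1..n. z i) / real n powr (3 / 4)"
  let ?b = "\<lambda>n. real n powr (- 1 / 4) * ((\<integral>z. \<bar>?Y n z - x\<bar> \<partial>?P n) + \<bar>x\<bar>)"
  have r: "(\<lambda>n. real n powr (- 1 / 4)) \<longlonglongrightarrow> 0" by real_asymp
  have "?b \<longlonglongrightarrow> 0 * (0 + \<bar>x\<bar>)"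
    by (intro tendsto_intros r sum_tilted_tendsto s)
  then show "?b \<longlonglongrightarrow> 0" by simp
  show "\<forall>\<^sub>F n in sequentially. norm (\<integral>z. \<bar>(\<Sum>i=1..n. z i) / n\<bar> \<partial>?P n) \<le> ?b n"
    using eventually_ge_at_top[of 1]
  proof eventually_elim
    case n: (elim n)
    interpret P: prob_space "?P n" by (intro prob_space_PiM prob_space_tilted_gauss s)
    have i: "integrable (?P n) (\<lambda>z. \<bar>?Y n z - x\<bar>)"
      by (intro integrable_abs Bochner_Integration.integrable_diff integrable_divide integrable_sum_tilted s n) simp
    have eq: "(\<Sum>i=1..n. z i) / n = real n powr (- 1 / 4) * ?Y n z" for z
    proof -
      have "real n powr (- 1 / 4) / real n powr (3 / 4) = 1 / real n"
        using n by (simp add: powr_diff[symmetric] powr_add[symmetric] powr_minus_divide)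
      moreover have "a * (t / b) = t * (a / b)" for a b t :: real
        by simp
      ultimately show ?thesis by (metis mult.right_neutral times_divide_eq_right)
    qed
    have "norm (\<integral>z. \<bar>(\<Sum>i=1..n. z i) / n\<bar> \<partial>?P n) = (\<integral>z. \<bar>(\<Sum>i=1..n. z i) / n\<bar> \<partial>?P n)"
      by simp
    also have "\<dots> \<le> (\<integral>z. real n powr (- 1 / 4) * (\<bar>?Y n z - x\<bar> + \<bar>x\<bar>) \<partial>?P n)"
    proof (rule integral_mono)
      show "integrable (?P n) (\<lambda>z. \<bar>(\<Sum>i=1..n. z i) / n\<bar>)"
        by (intro integrable_abs integrable_divide integrable_sum_tilted s n)
      show "integrable (?P n) (\<lambda>z. real n powr (- 1 / 4) * (\<bar>?Y n z - x\<bar> + \<bar>x\<bar>))"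
        by (intro integrable_mult_right Bochner_Integration.integrable_add i) simp
      show "\<bar>(\<Sum>i=1..n. z i) / n\<bar> \<le> real n powr (- 1 / 4) * (\<bar>?Y n z - x\<bar> + \<bar>x\<bar>)" for z
        unfolding eq abs_mult by (intro mult_mono) auto
    qed
    also have "\<dots> = ?b n" using i by (simp add: P.prob_space)
    finally show ?case .
  qed
qed

text \<open>\<open>cts_step a b\<close> is Lipschitz with constant \<open>1 / (b - a)\<close>, so
  convergence of \<open>S / n powr (3 / 4)\<close> to \<open>x\<close> in mean under the tilted laws
  carries over to its image, and the limit function is \<open>cts_step a b\<close> itself.\<close>

lemma weak_limit_mu_tilde:
  assumes s: "0 < \<sigma>" and P: "\<And>n. 1 \<le> n \<Longrightarrow> prob_space (mu_tilde n \<sigma>)" and ab: "a < b"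
  shows "(\<lambda>n. \<integral>z. cts_step a b ((\<Sum>i=1..n. z i) / real n powr (3 / 4)) \<partial>mu_tilde n \<sigma>)
    \<longlonglongrightarrow> (\<integral>x. cts_step a b x \<partial>quartic_measure \<sigma>)"
proof (rule integral_mu_tilde_tendsto[OF s P])
  have cts [measurable]: "cts_step a b \<in> borel_measurable borel"
    using ab by (intro borel_measurable_continuous_onI uniformly_continuous_imp_continuous cts_step_uniformly_continuous)
  show "(\<lambda>z. cts_step a b ((\<Sum>i=1..n. z i) / real n powr (3 / 4))) \<in> borel_measurable (PiM {1..n} (\<lambda>_. borel))" for n
    by measurable
  show "cts_step a b \<in> borel_measurable borel" by (rule cts)
  have c01: "0 \<le> cts_step a b t" "cts_step a b t \<le> 1" for t
    using ab by (auto simp: cts_step_def field_simps)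
  show "0 \<le> cts_step a b t" "cts_step a b t \<le> 1" "0 \<le> cts_step a b t" "cts_step a b t \<le> 1" for t
    by (fact c01)+
  fix x
  let ?P = "\<lambda>n. tilted n \<sigma> (tilt_scale \<sigma> x n)"
  let ?Y = "\<lambda>n z. (\<Sum>i=1..n. z i) / real n powr (3 / 4)"
  have lip: "\<bar>cts_step a b u - cts_step a b v\<bar> \<le> \<bar>u - v\<bar> / (b - a)" for u v
  proof -
    \<comment> \<open>The function is an affine one truncated to \<open>[0, 1]\<close>, and
      truncation does not increase distances.\<close>
    have clamp: "cts_step a b t = max 0 (min 1 ((b - t) / (b - a)))" for t
      using ab by (auto simp: cts_step_def field_simps max_def min_def)
    have "(b - u) / (b - a) - (b - v) / (b - a) = (v - u) / (b - a)"
      by (simp add: diff_divide_distrib)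
    then have "\<bar>(b - u) / (b - a) - (b - v) / (b - a)\<bar> = \<bar>u - v\<bar> / (b - a)"
      using ab by (simp add: abs_minus_commute)
    then show ?thesis unfolding clamp by linarith
  qed
  show "(\<lambda>n. \<integral>z. \<bar>cts_step a b (?Y n z) - cts_step a b x\<bar> \<partial>?P n) \<longlonglongrightarrow> 0"
  proof (rule Lim_null_comparison)
    have "(\<lambda>n. (\<integral>z. \<bar>?Y n z - x\<bar> \<partial>?P n) / (b - a)) \<longlonglongrightarrow> 0 / (b - a)"
      using ab by (intro tendsto_divide tendsto_const sum_tilted_tendsto s) auto
    then show "(\<lambda>n. (\<integral>z. \<bar>?Y n z - x\<bar> \<partial>?P n) / (b - a)) \<longlonglongrightarrow> 0" by simp
    show "\<forall>\<^sub>F n in sequentially. norm (\<integral>z. \<bar>cts_step a b (?Y n z) - cts_step a b x\<bar> \<partial>?P n)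
        \<le> (\<integral>z. \<bar>?Y n z - x\<bar> \<partial>?P n) / (b - a)"
      using eventually_ge_at_top[of 1]
    proof eventually_elim
      case n: (elim n)
      interpret P: prob_space "?P n" by (intro prob_space_PiM prob_space_tilted_gauss s)
      have i: "integrable (?P n) (\<lambda>z. \<bar>?Y n z - x\<bar> / (b - a))"
        by (intro integrable_divide integrable_abs Bochner_Integration.integrable_diff integrable_sum_tilted s n) simp
      have "integrable (?P n) (\<lambda>z. \<bar>cts_step a b (?Y n z) - cts_step a b x\<bar>)"
      proof (rule Bochner_Integration.integrable_bound[OF i])
        show "AE z in ?P n. norm \<bar>cts_step a b (?Y n z) - cts_step a b x\<bar> \<le> norm (\<bar>?Y n z - x\<bar> / (b - a))"
          unfolding real_norm_def abs_idempotent by (intro AE_I2 order_trans[OF lip abs_ge_self])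
      qed measurable
      then have "(\<integral>z. \<bar>cts_step a b (?Y n z) - cts_step a b x\<bar> \<partial>?P n) \<le> (\<integral>z. \<bar>?Y n z - x\<bar> / (b - a) \<partial>?P n)"
        by (intro integral_mono i lip)
      then show ?case by simp
    qed
  qed
qed

text \<open>Markov's inequality under each tilted law: the indicator is at most the sum of the two
  deviations divided by \<open>\<epsilon>\<close>. The limit point is the same for every
  \<open>x\<close>, so the limit function is the constant 0.\<close>

lemma law_of_large_numbers_mu_tilde:
  assumes s: "0 < \<sigma>" and P: "\<And>n. 1 \<le> n \<Longrightarrow> prob_space (mu_tilde n \<sigma>)" and e: "0 < \<epsilon>"
  shows "(\<lambda>n. \<integral>z. (if \<epsilon> < dist ((\<Sum>i=1..n. z i) / n, (\<Sum>i=1..n. (z i)\<^sup>2) / n) (0, \<sigma>\<^sup>2) then 1 else 0 :: real)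
      \<partial>mu_tilde n \<sigma>) \<longlonglongrightarrow> 0"
proof -
  let ?S = "\<lambda>n z. (\<Sum>i=1..n. z i) / real n" and ?T = "\<lambda>n z. (\<Sum>i=1..n. (z i)\<^sup>2) / real n"
  let ?F = "\<lambda>n z. if \<epsilon> < dist (?S n z, ?T n z) (0, \<sigma>\<^sup>2) then 1 else 0 :: real"
  have le: "?F n z \<le> (\<bar>?S n z\<bar> + \<bar>?T n z - \<sigma>\<^sup>2\<bar>) / \<epsilon>" for n z
  proof -
    have "dist (?S n z, ?T n z) (0, \<sigma>\<^sup>2) \<le> \<bar>?S n z\<bar> + \<bar>?T n z - \<sigma>\<^sup>2\<bar>"
      unfolding dist_Pair_Pair dist_real_def
      using sqrt_sum_squares_le_sum_abs[of "\<bar>?S n z\<bar>" "\<bar>?T n z - \<sigma>\<^sup>2\<bar>"] by simp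
    then show ?thesis using e by (auto simp: pos_le_divide_eq)
  qed
  have "(\<lambda>n. \<integral>z. ?F n z \<partial>mu_tilde n \<sigma>) \<longlonglongrightarrow> (\<integral>x. 0 \<partial>quartic_measure \<sigma>)"
  proof (rule integral_mu_tilde_tendsto[OF s P])
    show meas: "?F n \<in> borel_measurable (PiM {1..n} (\<lambda>_. borel))" for n
      unfolding dist_Pair_Pair by measurable
    fix x
    let ?P = "\<lambda>n. tilted n \<sigma> (tilt_scale \<sigma> x n)"
    show "(\<lambda>n. \<integral>z. \<bar>?F n z - 0\<bar> \<partial>?P n) \<longlonglongrightarrow> 0"
    proof (rule Lim_null_comparison)
      let ?b = "\<lambda>n. ((\<integral>z. \<bar>?S n z\<bar> \<partial>?P n) + (\<integral>z. \<bar>?T n z - \<sigma>\<^sup>2\<bar> \<partial>?P n)) / \<epsilon>"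
      have "?b \<longlonglongrightarrow> (0 + 0) / \<epsilon>"
        using e by (intro tendsto_divide tendsto_add tendsto_const mean_tilted_tendsto square_mean_tilted_tendsto s) auto
      then show "?b \<longlonglongrightarrow> 0" by simp
      show "\<forall>\<^sub>F n in sequentially. norm (\<integral>z. \<bar>?F n z - 0\<bar> \<partial>?P n) \<le> ?b n"
        using eventually_ge_at_top[of 1]
      proof eventually_elim
        case n: (elim n)
        interpret P: prob_space "?P n" by (intro prob_space_PiM prob_space_tilted_gauss s)
        have iS: "integrable (?P n) (\<lambda>z. \<bar>?S n z\<bar>)"
          by (intro integrable_abs integrable_divide integrable_sum_tilted s n)
        have iT: "integrable (?P n) (\<lambda>z. \<bar>?T n z - \<sigma>\<^sup>2\<bar>)"
          by (intro integrable_abs L1_square_mean_tilted s n)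
        have "?F n \<in> borel_measurable (?P n)"
          using meas[of n] sets_PiM_real[of "\<lambda>_. tilted_gauss \<sigma> (tilt_scale \<sigma> x n)" "{1..n}"]
          by (simp cong: measurable_cong_sets)
        then have iF: "integrable (?P n) (?F n)"
          by (intro P.integrable_const_bound[where B = 1]) auto
        have "norm (\<integral>z. \<bar>?F n z - 0\<bar> \<partial>?P n) = (\<integral>z. ?F n z \<partial>?P n)"
          by (simp add: abs_of_nonneg Bochner_Integration.integral_nonneg)
        also have "\<dots> \<le> (\<integral>z. (\<bar>?S n z\<bar> + \<bar>?T n z - \<sigma>\<^sup>2\<bar>) / \<epsilon> \<partial>?P n)"
          by (intro integral_mono iF integrable_divide Bochner_Integration.integrable_add iS iT le)
        also have "\<dots> = ?b n"
          using iS iT by simp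
        finally show ?case .
      qed
    qed
  qed auto
  then show ?thesis by simp
qed

section \<open>Transfer from the measures to random vectors with these laws\<close>

theorem theorem1:
  fixes \<sigma> :: real
    and M :: "nat \<Rightarrow> 'a measure"
    and X :: "nat \<Rightarrow> 'a \<Rightarrow> nat \<Rightarrow> real"
    and S T :: "nat \<Rightarrow> 'a \<Rightarrow> real"
  assumes "\<sigma> > 0"
    and "\<And>n. n \<ge> 1 \<Longrightarrow> prob_space (M n)"
    and "\<And>n. n \<ge> 1 \<Longrightarrow> X n \<in> measurable (M n) (PiM {1..n} (\<lambda>_. borel))"
    and "\<And>n. n \<ge> 1 \<Longrightarrow> distr (M n) (PiM {1..n} (\<lambda>_. borel)) (X n) = mu_tilde n \<sigma>"
    and "\<And>n \<omega>. S n \<omega> = (\<Sum>i=1..n. X n \<omega> i)"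
    and "\<And>n \<omega>. T n \<omega> = (\<Sum>i=1..n. (X n \<omega> i)\<^sup>2)"
  shows "conv_in_prob M (\<lambda>n \<omega>. (S n \<omega> / real n, T n \<omega> / real n)) (0, \<sigma>\<^sup>2)
       \<and> prob_space (quartic_measure \<sigma>)
       \<and> weak_conv_m (\<lambda>n. distr (M n) borel (\<lambda>\<omega>. S n \<omega> / real n powr (3 / 4)))
                      (quartic_measure \<sigma>)"
proof (intro conjI)
  note s = assms(1) and law = assms(4)
  note Xm [measurable] = assms(3)
  \<comment> \<open>Being the law of a random vector, \<open>mu_tilde n \<sigma>\<close> has total
    mass 1; this is what identifies the normalisation in \<open>integral_mu_tilde\<close>.\<close>
  have P: "prob_space (mu_tilde n \<sigma>)" if "1 \<le> n" for n
    using prob_space.prob_space_distr[OF assms(2)[OF that] Xm[OF that]] law[OF that] by simp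
  have transfer: "(\<integral>\<omega>. f (X n \<omega>) \<partial>M n) = (\<integral>z. f z \<partial>mu_tilde n \<sigma>)"
    if "1 \<le> n" "f \<in> borel_measurable (PiM {1..n} (\<lambda>_. borel))" for n and f :: "(nat \<Rightarrow> real) \<Rightarrow> real"
    unfolding law[OF that(1), symmetric] by (rule integral_distr[symmetric]) (use that Xm in auto)
  show Q: "prob_space (quartic_measure \<sigma>)" by (rule prob_space_quartic_measure[OF s])
  show "conv_in_prob M (\<lambda>n \<omega>. (S n \<omega> / real n, T n \<omega> / real n)) (0, \<sigma>\<^sup>2)"
    unfolding conv_in_prob_def
  proof (intro allI impI)
    fix \<epsilon> :: real assume e: "0 < \<epsilon>"
    let ?A = "\<lambda>n z. \<epsilon> < dist ((\<Sum>i=1..n. z i) / real n, (\<Sum>i=1..n. (z i)\<^sup>2) / real n) (0, \<sigma>\<^sup>2)"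
    have eq: "(\<integral>z. (if ?A n z then 1 else 0 :: real) \<partial>mu_tilde n \<sigma>)
        = measure (M n) {\<omega> \<in> space (M n). \<epsilon> < dist (S n \<omega> / real n, T n \<omega> / real n) (0, \<sigma>\<^sup>2)}"
      if n: "1 \<le> n" for n
    proof -
      interpret prob_space "M n" by (rule assms(2)[OF n])
      have A [measurable]: "Measurable.pred (PiM {1..n} (\<lambda>_. borel)) (?A n)"
        unfolding dist_Pair_Pair by measurable
      have [measurable]: "{\<omega> \<in> space (M n). ?A n (X n \<omega>)} \<in> sets (M n)"
        using measurable_compose[OF Xm[OF n] A] by (simp add: pred_def)
      have "(\<integral>z. (if ?A n z then 1 else 0 :: real) \<partial>mu_tilde n \<sigma>) = (\<integral>\<omega>. (if ?A n (X n \<omega>) then 1 else 0 :: real) \<partial>M n)"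
        by (rule transfer[OF n, symmetric]) measurable
      also have "\<dots> = (\<integral>\<omega>. indicator {\<omega> \<in> space (M n). ?A n (X n \<omega>)} \<omega> \<partial>M n)"
        by (intro Bochner_Integration.integral_cong refl) (simp add: indicator_def)
      also have "\<dots> = measure (M n) {\<omega> \<in> space (M n). ?A n (X n \<omega>)}"
        by simp
      finally show ?thesis by (simp add: assms(5,6))
    qed
    show "(\<lambda>n. measure (M n) {\<omega> \<in> space (M n). \<epsilon> < dist (S n \<omega> / real n, T n \<omega> / real n) (0, \<sigma>\<^sup>2)}) \<longlonglongrightarrow> 0"
    proof (rule Lim_transform_eventually)
      show "(\<lambda>n. \<integral>z. (if ?A n z then 1 else 0 :: real) \<partial>mu_tilde n \<sigma>) \<longlonglongrightarrow> 0"
        by (rule law_of_large_numbers_mu_tilde[OF s _ e]) (rule P)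
    qed (rule eventually_mono[OF eventually_ge_at_top[of 1] eq])
  qed
  \<comment> \<open>The index is shifted because nothing is assumed about \<open>M 0\<close>.\<close>
  define D where "D n = distr (M (Suc n)) borel (\<lambda>\<omega>. S (Suc n) \<omega> / real (Suc n) powr (3 / 4))" for n
  have Sm: "(\<lambda>\<omega>. S n \<omega> / real n powr (3 / 4)) \<in> borel_measurable (M n)" if n: "1 \<le> n" for n
  proof -
    have "(\<lambda>z. (\<Sum>i=1..n. z i) / real n powr (3 / 4)) \<in> borel_measurable (PiM {1..n} (\<lambda>_. borel))"
      by measurable
    from measurable_compose[OF Xm[OF n] this] show ?thesis by (simp add: assms(5))
  qed
  \<comment> \<open>Weak convergence follows from convergence of the integrals of the functions
    \<open>cts_step x y\<close>, which are continuous approximations of indicators of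
    half-lines.\<close>
  have "weak_conv_m D (quartic_measure \<sigma>)"
  proof (rule integral_cts_step_conv_imp_weak_conv)
    fix n
    interpret prob_space "M (Suc n)" by (rule assms(2)) simp
    show "real_distribution (D n)"
      unfolding D_def by (rule real_distribution_distr) (use Sm[of "Suc n"] in simp)
  next
    show "real_distribution (quartic_measure \<sigma>)"
      using Q by (simp add: real_distribution_def real_distribution_axioms_def quartic_measure_def)
  next
    fix x y :: real assume xy: "x < y"
    let ?I = "\<lambda>n. \<integral>z. cts_step x y ((\<Sum>i=1..n. z i) / real n powr (3 / 4)) \<partial>mu_tilde n \<sigma>"
    have cts [measurable]: "cts_step x y \<in> borel_measurable borel"
      using xy by (intro borel_measurable_continuous_onI uniformly_continuous_imp_continuous cts_step_uniformly_continuous)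
    have "integral\<^sup>L (D n) (cts_step x y) = ?I (Suc n)" for n
    proof -
      have "integral\<^sup>L (D n) (cts_step x y)
          = (\<integral>\<omega>. cts_step x y ((\<Sum>i=1..Suc n. X (Suc n) \<omega> i) / real (Suc n) powr (3 / 4)) \<partial>M (Suc n))"
        unfolding D_def assms(5)[symmetric] by (rule integral_distr) (use Sm[of "Suc n"] in simp_all)
      also have "\<dots> = ?I (Suc n)"
        by (rule transfer) (simp, measurable)
      finally show ?thesis .
    qed
    then show "(\<lambda>n. integral\<^sup>L (D n) (cts_step x y)) \<longlonglongrightarrow> integral\<^sup>L (quartic_measure \<sigma>) (cts_step x y)"
      using LIMSEQ_Suc[OF weak_limit_mu_tilde[OF s _ xy]] P by simp
  qed
  \<comment> \<open>At each continuity point, convergence of the distribution functions is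
    unaffected by the shift of the index.\<close>
  then show "weak_conv_m (\<lambda>n. distr (M n) borel (\<lambda>\<omega>. S n \<omega> / real n powr (3 / 4))) (quartic_measure \<sigma>)"
    unfolding weak_conv_m_def weak_conv_def
  proof (intro allI impI)
    fix x
    assume "\<forall>x. isCont (cdf (quartic_measure \<sigma>)) x \<longrightarrow> (\<lambda>n. cdf (D n) x) \<longlonglongrightarrow> cdf (quartic_measure \<sigma>) x"
      and "isCont (cdf (quartic_measure \<sigma>)) x"
    then have "(\<lambda>n. cdf (D n) x) \<longlonglongrightarrow> cdf (quartic_measure \<sigma>) x" by blast
    then show "(\<lambda>n. cdf (distr (M n) borel (\<lambda>\<omega>. S n \<omega> / real n powr (3 / 4))) x) \<longlonglongrightarrow> cdf (quartic_measure \<sigma>) x"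
      unfolding D_def by (rule LIMSEQ_imp_Suc)
  qed
qed

end
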